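(* Let $\Omega=[0,1]^d$, $s\ge0$, $k\in\mathbb{Z}_{\ge0}$, and $0\le m\le s$. Then there is a function $f\in\mathcal{B}^s(\Omega)$ and a constant $c>0$ (independent of $n$) such that for all integers $n\ge1$ $$\inf_{f_n\in \Sigma^k_{n}} \|f - f_n\|_{H^m(\Omega)} \ge c\, n^{m-(k+1)}.$$
   Context: Here $d\ge1$ is an integer. The Fourier transform is $\hat g(\xi)=\int_{\mathbb{R}^d} g(x)e^{-2\pi \mathrm{i}\,\xi\cdot x}\,dx$, and $|\cdot|$ is the Euclidean norm. For $s\ge 0$, the spectral Barron space is $$\mathcal{B}^s(\Omega)=\Big\{f:\Omega\to\mathbb{C}:\ \|f\|_{\mathcal{B}^s(\Omega)}:=\inf_{f_e|_\Omega=f}\int_{\mathbb{R}^d}(1+|\xi|)^s|\hat f_e(\xi)|\,d\xi<\infty\Big\},$$ where the infimum is over extensions $f_e\in L^1(\mathbb{R}^d)$ of $f$. The activation function is $\sigma_k(x)=[\max(0,x)]^k$, with the convention $0^0=0$, so that $\sigma_0$ is the Heaviside function ($0$ for $x\le0$, $1$ for $x>0$). Set $$\Sigma^k_n=\Big\{\sum_{i=1}^n a_i\sigma_k(\omega_i\cdot x+b_i):\ \omega_i\in S^{d-1},\ b_i\in\mathbb{R},\ a_i\in\mathbb{C}\Big\},$$ where $S^{d-1}$ is the unit sphere in $\mathbb{R}^d$. $H^m(\Omega)$ is the usual $L^2$-based Sobolev space of order $m$ (the fractional, Sobolev–Slobodeckij, space if $m$ is not an integer), with $H^0=L^2$; the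 norm is $+\infty$ for functions not in $H^m(\Omega)$. Functions are identified when equal almost everywhere.
   Formalization: The condition m ≤ k+1 is added: for m > k+1 the claim is false, since 0 lies in Σ^k_n and every f in B^s(Ω) with s ≥ m has finite H^m(Ω) norm, while c n^{m-(k+1)} tends to infinity. *)

theory Defs
  imports "HOL-Analysis.Analysis"
begin

text \<open>
  Complex functions on a set \<open>\<Omega> \<subseteq> \<real>\<^sup>d\<close> are represented by total functions on \<open>real ^ 'd\<close> of which
  only the values on \<open>\<Omega>\<close> matter, up to null sets; \<open>d = CARD('d)\<close>.
\<close>

subsection \<open>The spectral Barron space\<close>

definition fourier :: "(real ^ 'd \<Rightarrow> complex) \<Rightarrow> real ^ 'd \<Rightarrow> complex" where
  "fourier g \<xi> = (LINT x|lebesgue. g x * exp (- 2 * of_real pi * \<i> * of_real (\<xi> \<bullet> x)))"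

definition extensions :: "(real ^ 'd) set \<Rightarrow> (real ^ 'd \<Rightarrow> complex) \<Rightarrow> (real ^ 'd \<Rightarrow> complex) set" where
  "extensions \<Omega> f = {fe. integrable lebesgue fe \<and> (AE x in lebesgue. x \<in> \<Omega> \<longrightarrow> fe x = f x)}"

text \<open>The infimum over an empty set of extensions is \<open>\<infinity>\<close>.\<close>

definition barron_norm :: "real \<Rightarrow> (real ^ 'd) set \<Rightarrow> (real ^ 'd \<Rightarrow> complex) \<Rightarrow> ennreal" where
  "barron_norm s \<Omega> f =
     (INF fe \<in> extensions \<Omega> f.
        \<integral>\<^sup>+ \<xi>. ennreal ((1 + norm \<xi>) powr s * cmod (fourier fe \<xi>)) \<partial>lebesgue)"

definition barron_space :: "real \<Rightarrow> (real ^ 'd) set \<Rightarrow> (real ^ 'd \<Rightarrow> complex) set" where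
  "barron_space s \<Omega> = {f. barron_norm s \<Omega> f < \<infinity>}"

subsection \<open>Shallow networks\<close>

text \<open>The guard implements \<open>0\<^sup>0 = 0\<close>; in HOL, \<open>0 ^ 0 = 1\<close>.\<close>

definition relu_pow :: "nat \<Rightarrow> real \<Rightarrow> real" where
  "relu_pow k t = (if k = 0 \<and> t \<le> 0 then 0 else (max 0 t) ^ k)"

definition networks :: "nat \<Rightarrow> nat \<Rightarrow> (real ^ 'd \<Rightarrow> complex) set" where
  "networks k n =
     {(\<lambda>x. \<Sum>i<n. a i * of_real (relu_pow k (\<omega> i \<bullet> x + b i))) | a \<omega> b.
        \<forall>i<n. \<omega> i \<in> sphere 0 1}"

subsection \<open>Sobolev spaces\<close>

definition partial :: "'d \<Rightarrow> (real ^ 'd \<Rightarrow> complex) \<Rightarrow> real ^ 'd \<Rightarrow> complex" where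
  "partial i \<phi> x = frechet_derivative \<phi> (at x) (axis i 1)"

definition smooth :: "(real ^ 'd \<Rightarrow> complex) \<Rightarrow> bool" where
  "smooth \<phi> \<longleftrightarrow> (\<forall>is. (foldr partial is \<phi>) differentiable_on UNIV)"

definition test_functions :: "(real ^ 'd) set \<Rightarrow> (real ^ 'd \<Rightarrow> complex) set" where
  "test_functions U =
     {\<phi>. smooth \<phi> \<and> compact (closure {x. \<phi> x \<noteq> 0}) \<and> closure {x. \<phi> x \<noteq> 0} \<subseteq> U}"

text \<open>
  Multi-indices are functions \<open>'d \<Rightarrow> nat\<close>. The index type carries no order, so an enumeration of the
  coordinates is chosen; by symmetry of second derivatives the choice is irrelevant for smooth
  functions, the only ones to which \<open>multi_partial\<close> is applied.
\<close>

definition coords :: "'d::finite list" where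
  "coords = (SOME is. distinct is \<and> set is = UNIV)"

definition multi_partial :: "('d::finite \<Rightarrow> nat) \<Rightarrow> (real ^ 'd \<Rightarrow> complex) \<Rightarrow> real ^ 'd \<Rightarrow> complex" where
  "multi_partial \<alpha> \<phi> = foldr (\<lambda>i. partial i ^^ \<alpha> i) coords \<phi>"

definition order_mi :: "('d::finite \<Rightarrow> nat) \<Rightarrow> nat" where
  "order_mi \<alpha> = (\<Sum>i\<in>UNIV. \<alpha> i)"

definition locally_integrable_on :: "(real ^ 'd) set \<Rightarrow> (real ^ 'd \<Rightarrow> complex) \<Rightarrow> bool" where
  "locally_integrable_on U f \<longleftrightarrow> (\<forall>K. compact K \<and> K \<subseteq> U \<longrightarrow> set_integrable lebesgue K f)"

definition is_weak_deriv ::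
    "(real ^ 'd) set \<Rightarrow> ('d::finite \<Rightarrow> nat) \<Rightarrow> (real ^ 'd \<Rightarrow> complex) \<Rightarrow> (real ^ 'd \<Rightarrow> complex) \<Rightarrow> bool" where
  "is_weak_deriv U \<alpha> f g \<longleftrightarrow>
     locally_integrable_on U f \<and> locally_integrable_on U g \<and>
     (\<forall>\<phi>\<in>test_functions U.
        (LINT x:U|lebesgue. f x * multi_partial \<alpha> \<phi> x)
          = (- 1) ^ order_mi \<alpha> * (LINT x:U|lebesgue. g x * \<phi> x))"

text \<open>Weak derivatives are unique up to null sets, so the chosen representative is irrelevant below.\<close>

definition weak_deriv ::
    "(real ^ 'd) set \<Rightarrow> ('d::finite \<Rightarrow> nat) \<Rightarrow> (real ^ 'd \<Rightarrow> complex) \<Rightarrow> real ^ 'd \<Rightarrow> complex" where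
  "weak_deriv U \<alpha> f = (SOME g. is_weak_deriv U \<alpha> f g)"

definition L2_sq :: "(real ^ 'd) set \<Rightarrow> (real ^ 'd \<Rightarrow> complex) \<Rightarrow> ennreal" where
  "L2_sq U g = (\<integral>\<^sup>+x\<in>U. ennreal ((cmod (g x))\<^sup>2) \<partial>lebesgue)"

definition slobodeckij_sq :: "real \<Rightarrow> (real ^ 'd) set \<Rightarrow> (real ^ 'd \<Rightarrow> complex) \<Rightarrow> ennreal" where
  "slobodeckij_sq \<theta> U g =
     (\<integral>\<^sup>+x\<in>U. (\<integral>\<^sup>+y\<in>U.
        ennreal ((cmod (g x - g y))\<^sup>2 / norm (x - y) powr (real CARD('d) + 2 * \<theta>))
      \<partial>lebesgue) \<partial>lebesgue)"

definition sobolev_sq :: "real \<Rightarrow> (real ^ 'd) set \<Rightarrow> (real ^ 'd \<Rightarrow> complex) \<Rightarrow> ennreal" where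
  "sobolev_sq m U f =
     (\<Sum>\<alpha> | order_mi \<alpha> \<le> nat \<lfloor>m\<rfloor>. L2_sq U (weak_deriv U \<alpha> f)) +
     (if m \<in> \<int> then 0
      else (\<Sum>\<alpha> | order_mi \<alpha> = nat \<lfloor>m\<rfloor>. slobodeckij_sq (frac m) U (weak_deriv U \<alpha> f)))"

text \<open>
  The norm of order \<open>m \<ge> 0\<close> on the interior of \<open>\<Omega>\<close>, with value \<open>\<infinity>\<close> exactly for the functions
  outside \<open>H\<^sup>m\<close>.
\<close>

definition sobolev_norm :: "real \<Rightarrow> (real ^ 'd) set \<Rightarrow> (real ^ 'd \<Rightarrow> complex) \<Rightarrow> ennreal" where
  "sobolev_norm m \<Omega> f =
     (if (\<forall>\<alpha>. order_mi \<alpha> \<le> nat \<lfloor>m\<rfloor> \<longrightarrow> (\<exists>g. is_weak_deriv (interior \<Omega>) \<alpha> f g))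
         \<and> sobolev_sq m (interior \<Omega>) f < \<infinity>
      then ennreal (sqrt (enn2real (sobolev_sq m (interior \<Omega>) f)))
      else \<infinity>)"

end

theory Submission
  imports Defs "HOL-Probability.Characteristic_Functions"
begin

text \<open>
  The function is the Gaussian \<open>f x = exp (- |x|\<^sup>2 / 2)\<close>, whose Fourier transform is again a Gaussian,
  so that \<open>f\<close> lies in every Barron space. A network with \<open>n\<close> neurons is a piecewise polynomial of
  degree at most \<open>k\<close> whose pieces are separated by \<open>n\<close> hyperplanes. Cut a fixed subcube into
  \<open>N\<^sup>d\<close> cells of side \<open>h\<close>, with \<open>N\<close> proportional to \<open>n\<close>. A hyperplane meets at most
  \<open>(d + 1) N\<^sup>d\<^sup>-\<^sup>1\<close> of them, so for \<open>N = 2 (d + 1) n\<close> at least half of the cells meet no hyperplane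
  (\<open>many_uncrossed_cells\<close>). On such a cell the network is one polynomial of degree at most \<open>k\<close>, and it cannot follow
  the derivative of order \<open>k + 1\<close> of \<open>f\<close>.

  This is made quantitative by duality, which works with the weak derivatives directly and never identifies them
  with classical ones. Fix a coordinate \<open>i\<close> and let \<open>j = \<lfloor>m\<rfloor>\<close>, \<open>r = k + 1 - j\<close>. Let \<open>\<psi>\<close> be a bump
  supported in an uncrossed cell, \<open>g\<close> a weak derivative \<open>\<partial>\<^sub>i\<^sup>j (f - f\<^sub>n)\<close>, and test \<open>g\<close> against
  \<open>\<phi> = \<partial>\<^sub>i\<^sup>r \<psi>\<close>. Up to sign,
    \<open>\<integral> g \<phi> = \<integral> (f - f\<^sub>n) \<partial>\<^sub>i\<^sup>k\<^sup>+\<^sup>1 \<psi> = \<integral> f \<partial>\<^sub>i\<^sup>k\<^sup>+\<^sup>1 \<psi> = \<integral> (\<partial>\<^sub>i\<^sup>k\<^sup>+\<^sup>1 f) \<psi>\<close>,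
  because \<open>k + 1\<close> derivatives annihilate the polynomial. The last integral is at least a constant times \<open>h\<^sup>d\<close>,
  provided that the subcube is chosen where \<open>\<partial>\<^sub>i\<^sup>k\<^sup>+\<^sup>1 f\<close> is bounded away from zero. Since \<open>|\<phi>|\<close> is at
  most a constant times \<open>h\<^sup>-\<^sup>r\<close>, the square integral of \<open>g\<close> over the cell is at least a constant times
  \<open>h\<^sup>d\<^sup>+\<^sup>2\<^sup>r\<close> (\<open>weak_derivative_cell_lower_bound\<close>).

  For integer \<open>m\<close>, summing over the uncrossed cells gives \<open>h\<^sup>2\<^sup>r\<close>, which has the order \<open>n\<close> to the power
  \<open>2 (m - (k + 1))\<close>. For fractional \<open>m = j + \<theta>\<close> we have \<open>r \<ge> 1\<close>, hence \<open>\<integral> \<phi> = 0\<close>, and the same bound holds for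
  \<open>g - w\<close> with any constant \<open>w\<close>. Taking \<open>w = g x\<close> for \<open>x\<close> in the cell, where distances are at most \<open>d h\<close>,
  the Slobodeckij double integral over the cells gains the factor \<open>h\<^sup>-\<^sup>2\<^sup>\<theta>\<close>, which is exactly the required order.
\<close>

section \<open>Smooth bumps supported in a cube\<close>

text \<open>
  With \<open>q = t (1 - t)\<close>, the derivative of order \<open>n\<close> of \<open>exp (- 1 / q)\<close> on the unit interval is
  \<open>bump_poly n / q\<^sup>2\<^sup>n * exp (- 1 / q)\<close>; the recursion is the product rule with the common denominator
  \<open>q\<^sup>2\<^sup>n\<^sup>+\<^sup>2\<close>. Writing down all derivatives at once makes smoothness a statement about this one family.
\<close>

primrec bump_poly :: "nat \<Rightarrow> real poly" where
  "bump_poly 0 = 1"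
| "bump_poly (Suc n) = pderiv (bump_poly n) * [:0, 1, -1:]\<^sup>2
     + (1 - smult (2 * real n) [:0, 1, -1:]) * [:1, -2:] * bump_poly n"

definition bump_deriv :: "nat \<Rightarrow> real \<Rightarrow> real" where
  "bump_deriv n t = (if 0 < t \<and> t < 1
     then poly (bump_poly n) t / (t * (1 - t)) ^ (2 * n) * exp (- (1 / (t * (1 - t)))) else 0)"

lemma power_le_fact_mult_exp:
  fixes w :: real
  assumes "w \<ge> 0"
  shows "w ^ m \<le> fact m * exp w"
proof -
  have s: "(\<lambda>m. w ^ m /\<^sub>R fact m) sums exp w" by (rule exp_converges)
  have "sum (\<lambda>m. w ^ m /\<^sub>R fact m) {m} \<le> suminf (\<lambda>m. w ^ m /\<^sub>R fact m)"
    using s assms by (intro sum_le_suminf) (auto simp: sums_iff)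
  then show ?thesis using s by (simp add: sums_iff field_simps)
qed

text \<open>
  The exponential beats every power of \<open>1 / q\<close>, which leaves the bound \<open>q\<^sup>2\<close>; and \<open>q\<close> is at most the distance
  from any point outside the open interval. Quadratic decay towards the points where the function vanishes yields
  derivative zero there, endpoints included.
\<close>

lemma bump_deriv_quadratic_bound:
  obtains C where "\<And>t t0. \<not> (0 < t0 \<and> t0 < 1) \<Longrightarrow> \<bar>bump_deriv n t\<bar> \<le> C * (t - t0)\<^sup>2"
proof -
  have "compact (poly (bump_poly n) ` {0..1})"
    by (intro compact_continuous_image continuous_intros) auto
  then obtain M where M: "\<And>t. t \<in> {0..1} \<Longrightarrow> \<bar>poly (bump_poly n) t\<bar> \<le> M"
    using compact_imp_bounded bounded_iff by (metis image_eqI real_norm_def)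
  have M0: "M \<ge> 0" using M[of 0] by auto
  show ?thesis
  proof (rule that)
    fix t t0 :: real
    assume t0: "\<not> (0 < t0 \<and> t0 < 1)"
    show "\<bar>bump_deriv n t\<bar> \<le> (M * fact (2 * n + 2)) * (t - t0)\<^sup>2"
    proof (cases "0 < t \<and> t < 1")
      case True
      define q where "q = t * (1 - t)"
      have q: "q > 0" using True by (simp add: q_def)
      have "q \<le> t" "q \<le> 1 - t"
        using True mult_left_le[of "1 - t" t] mult_left_le[of t "1 - t"] by (auto simp: q_def mult.commute)
      then have "q \<le> \<bar>t - t0\<bar>" using t0 True by auto
      then have q2: "q\<^sup>2 \<le> (t - t0)\<^sup>2" using q by (metis abs_of_pos power2_le_iff_abs_le power2_abs abs_ge_zero less_imp_le power_mono)
      have "exp (- (1 / q)) * (1 / q) ^ (2 * n + 2) \<le> fact (2 * n + 2)"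
        using power_le_fact_mult_exp[of "1 / q" "2 * n + 2"] q
        by (simp add: exp_minus inverse_eq_divide pos_divide_le_eq del: fact_Suc power_Suc)
      then have "exp (- (1 / q)) / q ^ (2 * n) / q\<^sup>2 \<le> fact (2 * n + 2)"
        by (simp only: power_add power_one_over) (simp add: divide_simps)
      then have "exp (- (1 / q)) / q ^ (2 * n) \<le> fact (2 * n + 2) * q\<^sup>2"
        using q by (simp only: pos_divide_le_eq zero_less_power)
      then have "\<bar>poly (bump_poly n) t\<bar> * (exp (- (1 / q)) / q ^ (2 * n)) \<le> M * (fact (2 * n + 2) * q\<^sup>2)"
        using M[of t] True q M0 by (intro mult_mono) auto
      also have "\<dots> \<le> M * (fact (2 * n + 2) * (t - t0)\<^sup>2)"
        using M0 q2 by (intro mult_left_mono) auto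
      finally show ?thesis using True q by (simp add: bump_deriv_def q_def[symmetric] abs_mult mult.assoc)
    qed (use M0 in \<open>auto simp: bump_deriv_def simp del: fact_Suc\<close>)
  qed
qed

lemma has_real_derivative_bump_deriv:
  "(bump_deriv n has_real_derivative bump_deriv (Suc n) t) (at t)"
proof (cases "0 < t \<and> t < 1")
  case True
  define q where "q = t * (1 - t)"
  have q: "q > 0" using True by (simp add: q_def)
  define p where "p = poly (bump_poly n) t"
  define p' where "p' = poly (pderiv (bump_poly n)) t"
  define W :: "real \<Rightarrow> real" where "W = (\<lambda>t. 1 / (t * (1 - t)))"
  define w where "w = W t"
  have dW: "(W has_real_derivative - ((1 - 2 * t) * w\<^sup>2)) (at t)"
  proof -
    have "((\<lambda>t. t * (1 - t)) has_real_derivative 1 - 2 * t) (at t)"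
      by (auto intro!: derivative_eq_intros)
    moreover have "t \<noteq> 0" "t \<noteq> 1" using True by auto
    ultimately show ?thesis
      using DERIV_inverse_fun[of "\<lambda>t. t * (1 - t)" "1 - 2 * t" t] unfolding W_def w_def
      by (auto simp: inverse_eq_divide power2_eq_square divide_simps)
  qed
  have "w = 1 / q" by (simp only: w_def W_def q_def)
  then have wq: "w * q = 1" using q by simp
  define m where "m = 2 * n"
  \<comment> \<open>The factor \<open>m\<close> hides the truncated exponent at \<open>m = 0\<close>.\<close>
  have m: "real m * (w\<^sup>2 * w ^ (m - Suc 0)) = real m * (w ^ m * w)"
    by (cases m) (auto simp: power2_eq_square)
  have "((\<lambda>t. poly (bump_poly n) t * W t ^ m * exp (- W t)) has_real_derivative
      (p' * w ^ m + real m * (- ((1 - 2 * t) * w\<^sup>2) * w ^ (m - Suc 0)) * p) * exp (- w)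
       + exp (- w) * - (- ((1 - 2 * t) * w\<^sup>2)) * (p * w ^ m)) (at t)"
    unfolding p_def p'_def w_def
    by (intro DERIV_mult DERIV_power DERIV_fun_exp DERIV_minus poly_DERIV dW[unfolded w_def])
  also have "(p' * w ^ m + real m * (- ((1 - 2 * t) * w\<^sup>2) * w ^ (m - Suc 0)) * p) * exp (- w)
       + exp (- w) * - (- ((1 - 2 * t) * w\<^sup>2)) * (p * w ^ m)
     = (p' * w ^ m + (w - real m) * (1 - 2 * t) * p * (w ^ m * w)) * exp (- w)"
    using arg_cong[OF m, of "\<lambda>y. y * ((1 - 2 * t) * p * exp (- w))"]
    by (simp add: algebra_simps power2_eq_square)
  also have "p' * w ^ m + (w - real m) * (1 - 2 * t) * p * (w ^ m * w)
      = (p' * q\<^sup>2 + (1 - real m * q) * (1 - 2 * t) * p) * w ^ (m + 2)"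
  proof -
    have "(p' * q\<^sup>2 + (1 - real m * q) * (1 - 2 * t) * p) * w ^ (m + 2)
       = p' * w ^ m * (w * q)\<^sup>2 + (w - real m * (w * q)) * (1 - 2 * t) * p * (w ^ m * w)"
      by (simp add: power_add power2_eq_square algebra_simps)
    then show ?thesis by (simp add: wq)
  qed
  also have "\<dots> * exp (- w) = bump_deriv (Suc n) t"
  proof -
    have "poly (bump_poly (Suc n)) t = p' * q\<^sup>2 + (1 - real m * q) * (1 - 2 * t) * p"
      by (simp add: p_def p'_def q_def m_def algebra_simps power2_eq_square)
    moreover have "2 * Suc n = m + 2" by (simp add: m_def)
    ultimately show ?thesis
      using True \<open>w = 1 / q\<close> by (simp only: bump_deriv_def q_def[symmetric] power_one_over if_True) simp
  qed
  finally show ?thesis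
    by (rule has_field_derivative_transform_within_open[of _ _ _ "{0<..<1}"])
       (use True in \<open>auto simp: bump_deriv_def W_def m_def power_divide\<close>)
next
  case False
  obtain C where C: "\<And>y. \<bar>bump_deriv n y\<bar> \<le> C * (y - t)\<^sup>2"
    using bump_deriv_quadratic_bound False by metis
  have "((\<lambda>y. (bump_deriv n y - bump_deriv n t) / (y - t)) \<longlongrightarrow> 0) (at t)"
  proof (rule Lim_null_comparison)
    show "\<forall>\<^sub>F y in at t. norm ((bump_deriv n y - bump_deriv n t) / (y - t)) \<le> C * \<bar>y - t\<bar>"
      using C False unfolding eventually_at_filter
      by (intro always_eventually allI impI)
         (auto simp: bump_deriv_def[of n t] divide_simps mult.assoc power2_eq_square abs_mult[symmetric])
    show "((\<lambda>y. C * \<bar>y - t\<bar>) \<longlongrightarrow> 0) (at t)" by (auto intro!: tendsto_eq_intros)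
  qed
  moreover have "bump_deriv (Suc n) t = 0" unfolding bump_deriv_def using False by (simp only: if_False)
  ultimately show ?thesis by (simp add: has_field_derivative_iff)
qed

lemma bump_deriv_bounded: obtains M where "M > 0" "\<And>t. \<bar>bump_deriv n t\<bar> \<le> M"
proof -
  have "continuous_on UNIV (bump_deriv n)"
    by (meson has_real_derivative_bump_deriv DERIV_isCont continuous_at_imp_continuous_on)
  then have "compact (bump_deriv n ` {0..1})"
    by (intro compact_continuous_image) (auto intro: continuous_on_subset)
  then obtain M where M: "\<And>t. t \<in> {0..1} \<Longrightarrow> \<bar>bump_deriv n t\<bar> \<le> M"
    using compact_imp_bounded bounded_iff by (metis image_eqI real_norm_def)
  have "\<bar>bump_deriv n t\<bar> \<le> \<bar>M\<bar> + 1" for t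
    using M[of t] by (cases "t \<in> {0..1}") (auto simp: bump_deriv_def)
  then show ?thesis using that[of "\<bar>M\<bar> + 1"] by auto
qed

text \<open>
  The partial derivative \<open>\<partial>\<^sup>\<alpha>\<close> of the bump \<open>x \<mapsto> \<Prod>i. bump_deriv 0 ((x\<^sub>i - z\<^sub>i) / h)\<close>, which lives on the open cube
  with corner \<open>z\<close> and side \<open>h\<close>. Carrying the multi-index along makes the family closed under \<open>partial\<close>.
\<close>

definition cell_bump :: "real ^ 'd \<Rightarrow> real \<Rightarrow> ('d::finite \<Rightarrow> nat) \<Rightarrow> real ^ 'd \<Rightarrow> complex" where
  "cell_bump z h \<alpha> x = of_real (\<Prod>i\<in>UNIV. bump_deriv (\<alpha> i) ((x $ i - z $ i) / h) / h ^ \<alpha> i)"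

lemma has_derivative_cell_bump:
  "(cell_bump z h \<alpha> has_derivative
      (\<lambda>v. \<Sum>i\<in>UNIV. of_real (v $ i) * cell_bump z h (\<alpha>(i := Suc (\<alpha> i))) x)) (at x)"
proof -
  have 1: "((\<lambda>x. bump_deriv (\<alpha> i) ((x $ i - z $ i) / h) / h ^ \<alpha> i) has_derivative
        (\<lambda>v. v $ i * (bump_deriv (Suc (\<alpha> i)) ((x $ i - z $ i) / h) / h ^ Suc (\<alpha> i)))) (at x)" for i x
  proof -
    have "((\<lambda>t. bump_deriv (\<alpha> i) ((t - z $ i) / h) / h ^ \<alpha> i) has_real_derivative
        bump_deriv (Suc (\<alpha> i)) ((x $ i - z $ i) / h) * (1 / h) / h ^ \<alpha> i) (at (x $ i))"
      by (intro DERIV_cdivide DERIV_chain'[where f = "\<lambda>t. (t - z $ i) / h"] has_real_derivative_bump_deriv)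
         (auto intro!: derivative_eq_intros)
    from has_derivative_compose[OF bounded_linear.has_derivative[OF bounded_linear_vec_nth has_derivative_ident]
        this[unfolded has_field_derivative_def]]
    show ?thesis by (simp add: ac_simps)
  qed
  have "((\<lambda>x. \<Prod>i\<in>UNIV. bump_deriv (\<alpha> i) ((x $ i - z $ i) / h) / h ^ \<alpha> i) has_derivative
       (\<lambda>v. \<Sum>i\<in>UNIV. v $ i * (bump_deriv (Suc (\<alpha> i)) ((x $ i - z $ i) / h) / h ^ Suc (\<alpha> i)) *
          (\<Prod>j\<in>UNIV - {i}. bump_deriv (\<alpha> j) ((x $ j - z $ j) / h) / h ^ \<alpha> j))) (at x)"
    by (rule has_derivative_prod) (rule 1)
  from bounded_linear.has_derivative[OF bounded_linear_of_real this]
  have 2: "(cell_bump z h \<alpha> has_derivative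
       (\<lambda>v. of_real (\<Sum>i\<in>UNIV. v $ i * (bump_deriv (Suc (\<alpha> i)) ((x $ i - z $ i) / h) / h ^ Suc (\<alpha> i)) *
          (\<Prod>j\<in>UNIV - {i}. bump_deriv (\<alpha> j) ((x $ j - z $ j) / h) / h ^ \<alpha> j)))) (at x)"
    by (simp only: cell_bump_def[abs_def])
  have 3: "cell_bump z h (\<alpha>(i := Suc (\<alpha> i))) x = of_real ((bump_deriv (Suc (\<alpha> i)) ((x $ i - z $ i) / h) / h ^ Suc (\<alpha> i)) *
          (\<Prod>j\<in>UNIV - {i}. bump_deriv (\<alpha> j) ((x $ j - z $ j) / h) / h ^ \<alpha> j))" for i
    unfolding cell_bump_def by (subst prod.remove[of UNIV i]) auto
  show ?thesis using 2 unfolding 3 by (simp only: of_real_sum of_real_mult mult.assoc)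
qed

lemma partial_cell_bump: "partial i (cell_bump z h \<alpha>) = cell_bump z h (\<alpha>(i := Suc (\<alpha> i)))"
proof
  fix x
  have "partial i (cell_bump z h \<alpha>) x
      = (\<Sum>j\<in>UNIV. of_real (axis i 1 $ j) * cell_bump z h (\<alpha>(j := Suc (\<alpha> j))) x)"
    unfolding partial_def frechet_derivative_at[OF has_derivative_cell_bump, symmetric] ..
  also have "\<dots> = cell_bump z h (\<alpha>(i := Suc (\<alpha> i))) x"
    by (subst sum.remove[of UNIV i]) (auto simp: axis_def intro!: sum.neutral)
  finally show "partial i (cell_bump z h \<alpha>) x = cell_bump z h (\<alpha>(i := Suc (\<alpha> i))) x" .
qed

lemma partial_power_cell_bump:
  "(partial i ^^ j) (cell_bump z h \<alpha>) = cell_bump z h (\<alpha>(i := \<alpha> i + j))"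
proof (induction j)
  case (Suc j)
  then show ?case by (simp add: partial_cell_bump) (simp add: fun_upd_def cong: if_cong)
qed simp

lemma smooth_cell_bump: "smooth (cell_bump z h \<alpha>)"
proof -
  have "\<exists>\<alpha>'. foldr partial is (cell_bump z h \<alpha>) = cell_bump z h \<alpha>'" for "is"
    by (induction "is") (auto simp: partial_cell_bump)
  moreover have "cell_bump z h \<alpha>' differentiable_on UNIV" for \<alpha>'
    using has_derivative_cell_bump
    by (meson differentiable_on_def differentiable_def has_derivative_at_withinI)
  ultimately show ?thesis unfolding smooth_def by metis
qed

lemma cell_bump_eq_0: 
  assumes "h > 0" "x \<notin> box z (z + h *\<^sub>R 1)"
  shows "cell_bump z h \<alpha> x = 0"
proof -
  obtain i where "\<not> (z $ i < x $ i \<and> x $ i < z $ i + h)"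
    using assms by (auto simp: mem_box_cart)
  then have "\<not> (0 < (x $ i - z $ i) / h \<and> (x $ i - z $ i) / h < 1)"
    using assms by (auto simp: field_simps)
  then have "bump_deriv (\<alpha> i) ((x $ i - z $ i) / h) = 0"
    unfolding bump_deriv_def by argo
  then show ?thesis unfolding cell_bump_def by (subst of_real_eq_0_iff) (auto intro!: prod_zero bexI[of _ i])
qed

lemma cell_bump_test_function:
  assumes "h > 0" "cbox z (z + h *\<^sub>R 1) \<subseteq> U"
  shows "cell_bump z h \<alpha> \<in> test_functions U"
proof -
  have "closure {x. cell_bump z h \<alpha> x \<noteq> 0} \<subseteq> cbox z (z + h *\<^sub>R 1)"
  proof (rule closure_minimal)
    show "{x. cell_bump z h \<alpha> x \<noteq> 0} \<subseteq> cbox z (z + h *\<^sub>R 1)"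
      using cell_bump_eq_0[OF assms(1)] subsetD[OF box_subset_cbox] by blast
  qed (rule closed_cbox)
  moreover from this have "compact (closure {x. cell_bump z h \<alpha> x \<noteq> 0})"
    by (meson bounded_subset bounded_cbox closed_closure compact_eq_bounded_closed)
  ultimately show ?thesis using assms smooth_cell_bump
    unfolding test_functions_def by blast
qed

lemma foldr_single:
  assumes "distinct is" "i \<in> set is"
  shows "foldr (\<lambda>l. (F l ^^ (if l = i then j else 0))) is = F i ^^ j"
proof -
  have *: "foldr (\<lambda>l. (F l ^^ (if l = i then j else 0))) ks = id" if "i \<notin> set ks" for ks
    using that by (induction ks) auto
  show ?thesis using assms
    by (induction "is") (auto simp: * fun_eq_iff)
qed

lemma multi_partial_single:
  "multi_partial (\<lambda>l. if l = i then j else 0) \<phi> = (partial i ^^ j) \<phi>"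
proof -
  have "distinct (coords :: 'a list) \<and> set (coords :: 'a list) = UNIV"
    unfolding coords_def by (rule someI_ex) (metis finite_distinct_list finite)
  then show ?thesis unfolding multi_partial_def by (subst foldr_single) auto
qed

text \<open>
  The scaling that fixes the rate: differentiating \<open>r\<close> times costs \<open>h\<^sup>-\<^sup>r\<close>, with a constant
  that depends neither on the cell nor on its size.
\<close>

lemma norm_cell_bump_le:
  fixes i :: "'d::finite"
  obtains M where "M > 0" "\<And>z h x. h > 0 \<Longrightarrow> 
     norm (cell_bump z h (\<lambda>l. if l = i then r else 0) x) \<le> M / h ^ r"
proof -
  obtain A where A: "A > 0" "\<And>t. \<bar>bump_deriv r t\<bar> \<le> A"
    using bump_deriv_bounded[of r] by blast
  obtain B where B: "B > 0" "\<And>t. \<bar>bump_deriv 0 t\<bar> \<le> B"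
    using bump_deriv_bounded[of 0] by blast
  have "norm (cell_bump z h (\<lambda>l. if l = i then r else 0) x) \<le> A * B ^ (CARD('d) - 1) / h ^ r" if h: "h > 0" for z h x
  proof -
    have "norm (cell_bump z h (\<lambda>l. if l = i then r else 0) x)
       = \<bar>bump_deriv r ((x $ i - z $ i) / h) / h ^ r\<bar> * (\<Prod>l\<in>UNIV - {i}. \<bar>bump_deriv 0 ((x $ l - z $ l) / h)\<bar>)"
      unfolding cell_bump_def by (subst prod.remove[of UNIV i]) (simp_all add: abs_mult abs_prod del: of_real_mult of_real_prod of_real_divide)
    also have "\<dots> \<le> (A / h ^ r) * (\<Prod>l\<in>UNIV - {i}. B)"
      using A B h by (intro mult_mono prod_mono prod_nonneg) (auto simp: divide_right_mono)
    finally show ?thesis by (simp add: card_Diff_singleton)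
  qed
  with A B that[of "A * B ^ (CARD('d) - 1)"] show ?thesis by simp
qed

text \<open>
  On the middle half of the interval \<open>q \<ge> 3/16\<close>, so the bump keeps a definite height on a concentric cube
  of half the side, whatever \<open>h\<close> is.
\<close>

lemma cell_bump_lower:
  fixes x :: "real ^ 'd::finite"
  assumes "h > 0" "x \<in> cbox (z + (h/4) *\<^sub>R 1) (z + (3*h/4) *\<^sub>R 1)"
  shows "exp (- (16 / 3)) ^ CARD('d) \<le> (\<Prod>l\<in>UNIV. bump_deriv 0 ((x $ l - z $ l) / h))"
proof -
  have "exp (- (16 / 3)) \<le> bump_deriv 0 ((x $ l - z $ l) / h)" for l
  proof -
    define t where "t = (x $ l - z $ l) / h"
    have t: "1 / 4 \<le> t" "t \<le> 3 / 4" using assms by (auto simp: t_def mem_box_cart field_simps)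
    have "(t - 1/4) * (3/4 - t) \<ge> 0" using t by simp
    then have "t * (1 - t) \<ge> 3 / 16" by (simp add: algebra_simps) (simp add: field_simps)
    then have "1 / (t * (1 - t)) \<le> 16 / 3" by (simp add: divide_simps split: if_splits)
    then show ?thesis using t by (simp add: bump_deriv_def t_def[symmetric])
  qed
  from prod_mono[of UNIV "\<lambda>_. exp (- (16 / 3))" "\<lambda>l. bump_deriv 0 ((x $ l - z $ l) / h)"] this
  show ?thesis by simp
qed

section \<open>Integration by parts along a coordinate\<close>

text \<open>
  The integral of \<open>G\<close> is invariant under translation, so the integrals of the difference quotients of \<open>G\<close>
  along \<open>e\<close> all vanish, and they converge to the integral of \<open>G'\<close> by dominated convergence. No iterated integration is
  involved.
\<close>

lemma integral_line_derivative_eq_0: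
  fixes G G' :: "'a::euclidean_space \<Rightarrow> complex"
  assumes d: "\<And>x. ((\<lambda>t. G (x + t *\<^sub>R e)) has_vector_derivative G' x) (at 0)"
    and contG: "continuous_on UNIV G" and contG': "continuous_on UNIV G'"
    and G0: "\<And>x. x \<notin> cball 0 R \<Longrightarrow> G x = 0"
    and G'0: "\<And>x. x \<notin> cball 0 R \<Longrightarrow> G' x = 0"
  shows "integral\<^sup>L lborel G' = 0"
proof -
  have [measurable]: "G \<in> borel_measurable borel" "G' \<in> borel_measurable borel"
    using contG contG' by (auto intro: borel_measurable_continuous_onI)
  have "compact (G' ` cball 0 R)"
    using contG' by (intro compact_continuous_image) (auto intro: continuous_on_subset)
  then obtain B where B: "\<And>x. x \<in> cball 0 R \<Longrightarrow> norm (G' x) \<le> B"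
    using compact_imp_bounded bounded_iff by (metis image_eqI)
  have B': "norm (G' x) \<le> \<bar>B\<bar>" for x
    using B[of x] G'0[of x] by (cases "x \<in> cball 0 R") auto
  have d': "((\<lambda>s. G (x + s *\<^sub>R e)) has_vector_derivative G' (x + t *\<^sub>R e)) (at t)" for x t
  proof -
    have "((\<lambda>s. s - t) has_vector_derivative 1) (at t)"
      by (auto intro!: derivative_eq_intros)
    from vector_diff_chain_at[OF this, of "\<lambda>s. G (x + t *\<^sub>R e + s *\<^sub>R e)" "G' (x + t *\<^sub>R e)"] d[of "x + t *\<^sub>R e"]
    show ?thesis by (simp add: o_def scaleR_left_diff_distrib)
  qed
  have lip: "norm (G (x + t *\<^sub>R e) - G x) \<le> \<bar>B\<bar> * \<bar>t\<bar>" for x t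
  proof -
    have "norm (G (x + t *\<^sub>R e) - G (x + 0 *\<^sub>R e)) \<le> \<bar>B\<bar> * norm (t - 0)"
    proof (rule differentiable_bound[of UNIV])
      show "((\<lambda>t. G (x + t *\<^sub>R e)) has_derivative (\<lambda>h. h *\<^sub>R G' (x + s *\<^sub>R e))) (at s within UNIV)" for s
        using d' by (simp add: has_vector_derivative_def)
      show "onorm (\<lambda>h. h *\<^sub>R G' (x + s *\<^sub>R e)) \<le> \<bar>B\<bar>" for s
        by (rule onorm_bound) (auto simp: mult.commute[of "\<bar>B\<bar>"] intro!: mult_left_mono B')
    qed auto
    then show ?thesis by simp
  qed
  define \<tau> where "\<tau> n = inverse (real (Suc n))" for n
  have \<tau>: "0 < \<tau> n" "\<tau> n \<le> 1" for n by (auto simp: \<tau>_def field_simps)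
  have intG: "integrable lborel G"
  proof -
    have "integrable lborel (\<lambda>x. indicator (cball 0 R) x *\<^sub>R G x)"
      using contG by (intro borel_integrable_compact) (auto intro: continuous_on_subset)
    moreover have "(\<lambda>x. indicator (cball 0 R) x *\<^sub>R G x) = G"
      using G0 by (auto simp: indicator_def fun_eq_iff)
    ultimately show ?thesis by simp
  qed
  have shift: "integrable lborel (\<lambda>x. G (x + c)) \<and> integral\<^sup>L lborel (\<lambda>x. G (x + c)) = integral\<^sup>L lborel G" for c
  proof -
    have "(\<lambda>x. G (x + c)) = (\<lambda>x. G (c + x))" by (simp add: add.commute)
    then show ?thesis
      using integral_distr[of "(+) c" lborel borel G] integrable_distr_eq[of "(+) c" lborel borel G] intG
      by (simp add: lborel_distr_plus)
  qed
  have "(\<lambda>n. integral\<^sup>L lborel (\<lambda>x. (G (x + \<tau> n *\<^sub>R e) - G x) /\<^sub>R \<tau> n)) \<longlonglongrightarrow> integral\<^sup>L lborel G'"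
  proof (rule integral_dominated_convergence)
    show "integrable lborel (\<lambda>x. indicator (cball (0::'a) (\<bar>R\<bar> + norm e)) x *\<^sub>R \<bar>B\<bar>)"
      by (intro borel_integrable_compact) auto
    show "AE x in lborel. norm ((G (x + \<tau> n *\<^sub>R e) - G x) /\<^sub>R \<tau> n)
            \<le> indicator (cball (0::'a) (\<bar>R\<bar> + norm e)) x *\<^sub>R \<bar>B\<bar>" for n
    proof (intro AE_I2)
      fix x
      show "norm ((G (x + \<tau> n *\<^sub>R e) - G x) /\<^sub>R \<tau> n) \<le> indicator (cball (0::'a) (\<bar>R\<bar> + norm e)) x *\<^sub>R \<bar>B\<bar>"
      proof (cases "x \<in> cball 0 (\<bar>R\<bar> + norm e)")
        case True
        then show ?thesis using lip[of x "\<tau> n"] \<tau>(1)[of n]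
          by (simp add: divide_inverse[symmetric] mult.commute[of "inverse _"] pos_divide_le_eq)
      next
        case False
        have "norm (x + \<tau> n *\<^sub>R e) \<ge> norm x - \<tau> n * norm e"
          using norm_triangle_ineq2[of x "- (\<tau> n *\<^sub>R e)"] \<tau>(1)[of n] by simp
        moreover have "\<tau> n * norm e \<le> norm e" using \<tau>[of n] by (intro mult_left_le_one_le) auto
        ultimately have "x + \<tau> n *\<^sub>R e \<notin> cball 0 R" using False by auto
        moreover have "x \<notin> cball 0 R" using False norm_ge_zero[of e] abs_ge_self[of R] by (simp del: norm_ge_zero abs_ge_self)
        ultimately show ?thesis using G0 False by simp
      qed
    qed
    show "AE x in lborel. (\<lambda>n. (G (x + \<tau> n *\<^sub>R e) - G x) /\<^sub>R \<tau> n) \<longlonglongrightarrow> G' x"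
    proof (intro AE_I2)
      fix x
      have "((\<lambda>t. norm (G (x + (0 + t) *\<^sub>R e) - G (x + 0 *\<^sub>R e) - t *\<^sub>R G' x) / norm t) \<longlongrightarrow> 0) (at 0)"
        using d[of x] unfolding has_vector_derivative_def has_derivative_at by blast
      then have "((\<lambda>t. (G (x + t *\<^sub>R e) - G x) /\<^sub>R t - G' x) \<longlongrightarrow> 0) (at 0)"
      proof (rule Lim_null_comparison[rotated])
        have "norm ((G (x + t *\<^sub>R e) - G x) /\<^sub>R t - G' x)
            = norm (G (x + (0 + t) *\<^sub>R e) - G (x + 0 *\<^sub>R e) - t *\<^sub>R G' x) / norm t" if "t \<noteq> 0" for t
        proof -
          have "(G (x + t *\<^sub>R e) - G x) /\<^sub>R t - G' x = (G (x + (0 + t) *\<^sub>R e) - G (x + 0 *\<^sub>R e) - t *\<^sub>R G' x) /\<^sub>R t"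
            using that by (simp add: scaleR_diff_right)
          then show ?thesis by (simp add: divide_inverse mult.commute)
        qed
        then show "\<forall>\<^sub>F t in at 0. norm ((G (x + t *\<^sub>R e) - G x) /\<^sub>R t - G' x)
            \<le> norm (G (x + (0 + t) *\<^sub>R e) - G (x + 0 *\<^sub>R e) - t *\<^sub>R G' x) / norm t"
          by (simp add: eventually_at_filter)
      qed
      then have "((\<lambda>t. (G (x + t *\<^sub>R e) - G x) /\<^sub>R t) \<longlongrightarrow> G' x) (at 0)"
        by (rule LIM_zero_cancel)
      moreover have "filterlim \<tau> (at 0) sequentially"
        using LIMSEQ_inverse_real_of_nat \<tau>(1) unfolding filterlim_at \<tau>_def
        by (auto simp del: of_nat_Suc)
      ultimately show "(\<lambda>n. (G (x + \<tau> n *\<^sub>R e) - G x) /\<^sub>R \<tau> n) \<longlonglongrightarrow> G' x"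
        using filterlim_compose by fastforce
    qed
  qed auto
  moreover have "integral\<^sup>L lborel (\<lambda>x. (G (x + \<tau> n *\<^sub>R e) - G x) /\<^sub>R \<tau> n) = 0" for n
    using shift[of "\<tau> n *\<^sub>R e"] intG by simp
  ultimately show ?thesis by (simp only: LIMSEQ_const_iff)
qed

lemma line_derivative_cell_bump:
  "((\<lambda>t. cell_bump z h (\<lambda>l. if l = i then j else 0) (x + t *\<^sub>R axis i 1)) has_vector_derivative
     cell_bump z h (\<lambda>l. if l = i then Suc j else 0) x) (at 0)"
proof -
  let ?\<alpha> = "\<lambda>l. if l = i then j else 0"
  have e: "?\<alpha>(i := Suc (?\<alpha> i)) = (\<lambda>l. if l = i then Suc j else 0)" by auto
  have "((\<lambda>t. x + t *\<^sub>R axis i (1::real)) has_derivative (\<lambda>t. t *\<^sub>R axis i 1)) (at 0)"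
    by (auto intro!: derivative_eq_intros)
  moreover have "(cell_bump z h ?\<alpha> has_derivative
      (\<lambda>v. \<Sum>l\<in>UNIV. of_real (v $ l) * cell_bump z h (?\<alpha>(l := Suc (?\<alpha> l))) x))
      (at (x + 0 *\<^sub>R axis i 1))"
    using has_derivative_cell_bump[of z h ?\<alpha> x] by simp
  ultimately have "((\<lambda>t. cell_bump z h ?\<alpha> (x + t *\<^sub>R axis i 1)) has_derivative
      (\<lambda>t. \<Sum>l\<in>UNIV. of_real ((t *\<^sub>R axis i (1::real)) $ l) * cell_bump z h (?\<alpha>(l := Suc (?\<alpha> l))) x)) (at 0)"
    by (rule has_derivative_compose)
  also have "(\<lambda>t. \<Sum>l\<in>UNIV. of_real ((t *\<^sub>R axis i (1::real)) $ l) * cell_bump z h (?\<alpha>(l := Suc (?\<alpha> l))) x)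
     = (\<lambda>t. t *\<^sub>R cell_bump z h (?\<alpha>(i := Suc (?\<alpha> i))) x)"
  proof
    fix t
    have "(\<Sum>l\<in>UNIV. of_real ((t *\<^sub>R axis i (1::real)) $ l) * cell_bump z h (?\<alpha>(l := Suc (?\<alpha> l))) x)
       = (\<Sum>l\<in>UNIV. if l = i then t *\<^sub>R cell_bump z h (?\<alpha>(i := Suc (?\<alpha> i))) x else 0)"
      by (intro sum.cong) (auto simp: axis_def scaleR_conv_of_real[where 'a = complex])
    then show "(\<Sum>l\<in>UNIV. of_real ((t *\<^sub>R axis i (1::real)) $ l) * cell_bump z h (?\<alpha>(l := Suc (?\<alpha> l))) x)
       = t *\<^sub>R cell_bump z h (?\<alpha>(i := Suc (?\<alpha> i))) x"
      by simp
  qed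
  finally show ?thesis unfolding has_vector_derivative_def e .
qed

lemma continuous_on_cell_bump: "continuous_on S (cell_bump z h \<alpha>)"
  using has_derivative_cell_bump has_derivative_continuous
  by (blast intro: continuous_at_imp_continuous_on)

lemma box_subset_some_cball: obtains R where "box a b \<subseteq> cball (0::'a::euclidean_space) R"
  using bounded_box[of a b] by (auto simp: bounded_iff subset_iff dist_norm)

lemma integrable_mult_cell_bump:
  assumes "continuous_on UNIV u" "h > 0"
  shows "integrable lborel (\<lambda>x. u x * cell_bump z h \<alpha> x)"
proof -
  have "integrable lborel (\<lambda>x. indicator (cbox z (z + h *\<^sub>R 1)) x *\<^sub>R (u x * cell_bump z h \<alpha> x))"
    using assms by (intro borel_integrable_compact continuous_intros continuous_on_cell_bump) (auto intro: continuous_on_subset)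
  moreover have "(\<lambda>x. indicator (cbox z (z + h *\<^sub>R 1)) x *\<^sub>R (u x * cell_bump z h \<alpha> x)) = (\<lambda>x. u x * cell_bump z h \<alpha> x)"
    using cell_bump_eq_0[OF assms(2)] box_subset_cbox by (fastforce simp: indicator_def fun_eq_iff)
  ultimately show ?thesis by simp
qed

text \<open>
  The functions \<open>u l\<close> stand for the successive derivatives \<open>\<partial>\<^sub>i\<^sup>l u\<close>. A sequence given in advance
  suits the two applications, where these derivatives have closed forms.
\<close>

lemma integral_by_parts_cell_bump:
  fixes u :: "nat \<Rightarrow> real ^ 'd::finite \<Rightarrow> complex"
  assumes h: "h > 0" and cont: "\<And>l. l \<le> L \<Longrightarrow> continuous_on UNIV (u l)"
    and d: "\<And>l x. l < L \<Longrightarrow> ((\<lambda>t. u l (x + t *\<^sub>R axis i 1)) has_vector_derivative u (Suc l) x) (at 0)"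
  shows "integral\<^sup>L lborel (\<lambda>x. u 0 x * cell_bump z h (\<lambda>l. if l = i then L else 0) x)
       = (-1) ^ L * integral\<^sup>L lborel (\<lambda>x. u L x * cell_bump z h (\<lambda>_. 0) x)"
proof -
  define \<psi> where "\<psi> j = cell_bump z h (\<lambda>l. if l = i then j else 0)" for j
  obtain R where R: "box z (z + h *\<^sub>R 1) \<subseteq> cball 0 R" by (rule box_subset_some_cball)
  have \<psi>0: "\<psi> j x = 0" if "x \<notin> cball 0 R" for j x
    using that R cell_bump_eq_0[OF h] unfolding \<psi>_def by blast
  have "a \<le> L \<Longrightarrow> integral\<^sup>L lborel (\<lambda>x. u 0 x * \<psi> L x) = (-1) ^ a * integral\<^sup>L lborel (\<lambda>x. u a x * \<psi> (L - a) x)" for a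
  proof (induction a)
    case (Suc a)
    define b where "b = L - Suc a"
    have b: "L - a = Suc b" using Suc.prems by (simp add: b_def)
    have "integral\<^sup>L lborel (\<lambda>x. u (Suc a) x * \<psi> b x + u a x * \<psi> (Suc b) x) = 0"
    proof (rule integral_line_derivative_eq_0[where G = "\<lambda>x. u a x * \<psi> b x" and e = "axis i 1" and R = R])
      show "((\<lambda>t. u a (x + t *\<^sub>R axis i 1) * \<psi> b (x + t *\<^sub>R axis i 1)) has_vector_derivative
         u (Suc a) x * \<psi> b x + u a x * \<psi> (Suc b) x) (at 0)" for x
        using has_vector_derivative_mult[OF d[of a x] line_derivative_cell_bump[of z h i b x]] Suc.prems
        by (simp add: \<psi>_def add.commute)
    qed (use Suc.prems in \<open>auto intro!: continuous_intros cont simp: continuous_on_cell_bump \<psi>_def[abs_def] \<psi>0[unfolded \<psi>_def]\<close>)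
    then have "integral\<^sup>L lborel (\<lambda>x. u (Suc a) x * \<psi> b x) + integral\<^sup>L lborel (\<lambda>x. u a x * \<psi> (Suc b) x) = 0"
      unfolding \<psi>_def using Suc.prems by (subst Bochner_Integration.integral_add[symmetric])
         (auto intro!: integrable_mult_cell_bump h cont)
    then have "integral\<^sup>L lborel (\<lambda>x. u a x * \<psi> (L - a) x) = - integral\<^sup>L lborel (\<lambda>x. u (Suc a) x * \<psi> (L - Suc a) x)"
      unfolding b b_def[symmetric] by (simp add: add_eq_0_iff)
    then show ?case using Suc by simp
  qed simp
  from this[of L] show ?thesis by (simp add: \<psi>_def)
qed

section \<open>The Gaussian, its Fourier transform and its derivatives\<close>

text \<open>
  Fubini for products of functions of one coordinate each, transported from the product measure over the basis vectors.
\<close>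

lemma integral_prod_components:
  fixes g :: "'d::finite \<Rightarrow> real \<Rightarrow> complex"
  assumes g: "\<And>i. integrable lborel (g i)"
  shows "integrable lborel (\<lambda>x::real ^ 'd. \<Prod>i\<in>UNIV. g i (x $ i))"
    and "integral\<^sup>L lborel (\<lambda>x::real ^ 'd. \<Prod>i\<in>UNIV. g i (x $ i)) = (\<Prod>i\<in>UNIV. integral\<^sup>L lborel (g i))"
proof -
  interpret product_sigma_finite "\<lambda>_::real ^ 'd. lborel :: real measure"
    by standard
  define e :: "'d \<Rightarrow> real ^ 'd" where "e i = axis i 1" for i
  have inj: "inj e" by (auto simp: inj_def e_def axis_eq_axis)
  have Basis: "Basis = range e" by (auto simp: Basis_vec_def e_def)
  have inv: "inv e (e i) = i" for i using inj by simp
  have m[measurable]: "g i \<in> borel_measurable borel" for i using g[of i] by auto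
  have int: "integrable lborel (g (inv e b))" for b by (rule g)
  have prodeq: "(\<Prod>i\<in>UNIV. F (e i)) = (\<Prod>b\<in>Basis. F b)" for F :: "real ^ 'd \<Rightarrow> complex"
    unfolding Basis using inj by (simp add: prod.reindex)
  have comp: "(\<Sum>b\<in>Basis. f b *\<^sub>R b) $ i = f (e i)" for f :: "real ^ 'd \<Rightarrow> real" and i
  proof -
    have "(\<Sum>b\<in>Basis. f b *\<^sub>R b) \<bullet> e i = f (e i)"
      by (rule inner_sum_left_Basis) (simp add: Basis)
    then show ?thesis by (simp add: e_def inner_axis)
  qed
  have eq: "(\<Prod>i\<in>UNIV. g i ((\<Sum>b\<in>Basis. f b *\<^sub>R b) $ i)) = (\<Prod>b\<in>Basis. g (inv e b) (f b))" for f
    unfolding comp using prodeq[of "\<lambda>b. g (inv e b) (f b)"] by (simp add: inv)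
  have meas: "(\<lambda>x::real ^ 'd. \<Prod>i\<in>UNIV. g i (x $ i)) \<in> borel_measurable borel"
    by measurable
  have T: "(\<lambda>f. \<Sum>b\<in>Basis. f b *\<^sub>R b) \<in> measurable (\<Pi>\<^sub>M b\<in>(Basis :: (real ^ 'd) set). lborel) borel"
    by measurable
  show "integrable lborel (\<lambda>x::real ^ 'd. \<Prod>i\<in>UNIV. g i (x $ i))"
    by (subst lborel_eq, subst integrable_distr_eq[OF T meas], unfold eq)
       (intro product_integrable_prod int, simp)
  show "integral\<^sup>L lborel (\<lambda>x::real ^ 'd. \<Prod>i\<in>UNIV. g i (x $ i)) = (\<Prod>i\<in>UNIV. integral\<^sup>L lborel (g i))"
    by (subst lborel_eq, subst integral_distr[OF T meas], unfold eq, subst product_integral_prod)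
       (use prodeq[of "\<lambda>b. integral\<^sup>L lborel (g (inv e b))"] in \<open>auto simp: int inv\<close>)
qed

definition gaussian :: "real ^ 'd::finite \<Rightarrow> complex" where
  "gaussian x = of_real (exp (- (norm x)\<^sup>2 / 2))"

lemma gaussian_eq_prod: "gaussian x = (\<Prod>i\<in>UNIV. of_real (exp (- (x $ i)\<^sup>2 / 2)))"
proof -
  have "- (norm x)\<^sup>2 / 2 = (\<Sum>i\<in>UNIV. - (x $ i)\<^sup>2 / 2)"
    by (simp add: norm_vec_def L2_set_def sum_nonneg sum_divide_distrib sum_negf)
  then show ?thesis by (simp only: gaussian_def exp_sum finite of_real_prod)
qed

text \<open>
  The characteristic function of the standard normal distribution, freed of its normalisation.
\<close>

lemma gaussian_char_real:
  fixes y :: real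
  shows "integrable lborel (\<lambda>t. of_real (exp (- t\<^sup>2 / 2)) * iexp (y * t))"
    and "integral\<^sup>L lborel (\<lambda>t. of_real (exp (- t\<^sup>2 / 2)) * iexp (y * t)) = of_real (sqrt (2 * pi) * exp (- y\<^sup>2 / 2))"
proof -
  have eq: "of_real (exp (- t\<^sup>2 / 2)) * iexp (y * t) = of_real (sqrt (2 * pi)) * (std_normal_density t *\<^sub>R iexp (y * t))" for t
    by (simp add: std_normal_density_def scaleR_conv_of_real)
  have "integrable std_normal_distribution (\<lambda>t. iexp (y * t))"
    by (intro prob_space.integrable_iexp prob_space_normal_density) auto
  then have 1: "integrable lborel (\<lambda>t. std_normal_density t *\<^sub>R iexp (y * t))"
    by (subst (asm) integrable_density) auto
  show "integrable lborel (\<lambda>t. of_real (exp (- t\<^sup>2 / 2)) * iexp (y * t))"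
    unfolding eq using 1 by (intro integrable_mult_right) 
  have "integral\<^sup>L std_normal_distribution (\<lambda>t. iexp (y * t)) = of_real (exp (- y\<^sup>2 / 2))"
    using fun_cong[OF char_std_normal_distribution, of y] by (simp add: char_def)
  then have "integral\<^sup>L lborel (\<lambda>t. std_normal_density t *\<^sub>R iexp (y * t)) = of_real (exp (- y\<^sup>2 / 2))"
    by (subst (asm) integral_density) auto
  then show "integral\<^sup>L lborel (\<lambda>t. of_real (exp (- t\<^sup>2 / 2)) * iexp (y * t)) = of_real (sqrt (2 * pi) * exp (- y\<^sup>2 / 2))"
    unfolding eq by (subst integral_mult_right_zero) simp
qed

lemma integrable_gaussian: "integrable lborel (gaussian :: real ^ 'd::finite \<Rightarrow> complex)"
  using integral_prod_components(1)[of "\<lambda>_ t. of_real (exp (- t\<^sup>2 / 2)) * iexp (0 * t)"] gaussian_char_real(1)[of 0]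
  by (simp add: gaussian_eq_prod[abs_def] del: of_real_exp)

lemma continuous_on_gaussian: "continuous_on S gaussian"
  unfolding gaussian_def by (intro continuous_intros) auto

lemma fourier_gaussian:
  "fourier gaussian \<xi> = of_real (sqrt (2 * pi) ^ CARD('d) * exp (- 2 * pi\<^sup>2 * (norm \<xi>)\<^sup>2))"
  for \<xi> :: "real ^ 'd::finite"
proof -
  have eq: "gaussian x * exp (- 2 * of_real pi * \<i> * of_real (\<xi> \<bullet> x))
      = (\<Prod>i\<in>UNIV. of_real (exp (- (x $ i)\<^sup>2 / 2)) * iexp ((- 2 * pi * \<xi> $ i) * x $ i))" for x
  proof -
    have "- 2 * of_real pi * \<i> * of_real (\<xi> \<bullet> x) = (\<Sum>i\<in>UNIV. \<i> * of_real ((- 2 * pi * \<xi> $ i) * x $ i))"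
      by (simp add: inner_vec_def sum_distrib_left mult_ac sum_negf)
    then show ?thesis by (simp only: gaussian_eq_prod prod.distrib exp_sum finite)
  qed
  have "fourier gaussian \<xi> = integral\<^sup>L lborel (\<lambda>x. gaussian x * exp (- 2 * of_real pi * \<i> * of_real (\<xi> \<bullet> x)))"
    unfolding fourier_def
    by (rule integral_completion) (auto intro!: borel_measurable_continuous_onI continuous_intros continuous_on_gaussian)
  also have "\<dots> = (\<Prod>i\<in>UNIV. of_real (sqrt (2 * pi) * exp (- (- 2 * pi * \<xi> $ i)\<^sup>2 / 2)))"
    unfolding eq by (subst integral_prod_components(2)) (simp_all only: gaussian_char_real)
  also have "\<dots> = of_real (sqrt (2 * pi) ^ CARD('d) * exp (\<Sum>i\<in>UNIV. - (- 2 * pi * \<xi> $ i)\<^sup>2 / 2))"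
    by (simp add: exp_sum prod.distrib)
  also have "(\<Sum>i\<in>UNIV. - (- 2 * pi * \<xi> $ i)\<^sup>2 / 2) = - 2 * pi\<^sup>2 * (norm \<xi>)\<^sup>2"
    by (simp add: norm_vec_def L2_set_def sum_nonneg sum_distrib_left power_mult_distrib sum_negf mult.assoc)
  finally show ?thesis .
qed

text \<open>
  The Gaussian is its own extension. The transform decays like \<open>exp (- 2 \<pi>\<^sup>2 |\<xi>|\<^sup>2)\<close>, which absorbs the polynomial
  weight and still leaves an integrable Gaussian.
\<close>

lemma gaussian_in_barron_space: "gaussian \<in> barron_space s (\<Omega> :: (real ^ 'd::finite) set)"
proof -
  define N where "N = nat \<lceil>\<bar>s\<bar>\<rceil>"
  define C where "C = fact N * exp 2 * sqrt (2 * pi) ^ CARD('d)"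
  have bound: "(1 + norm \<xi>) powr s * cmod (fourier gaussian \<xi>) \<le> C * exp (- (norm \<xi>)\<^sup>2 / 2)" for \<xi> :: "real ^ 'd"
  proof -
    define r where "r = norm \<xi>"
    have r: "r \<ge> 0" by (simp add: r_def)
    have "(1 + r) powr s \<le> (1 + r) powr real N"
      using r by (intro powr_mono) (auto simp: N_def intro: order_trans[OF abs_ge_self])
    also have "\<dots> = (1 + r) ^ N" using r by (simp add: powr_realpow)
    also have "\<dots> \<le> fact N * exp (1 + r)"
      using power_le_fact_mult_exp[of "1 + r" N] r by simp
    finally have 1: "(1 + r) powr s \<le> fact N * exp (1 + r)" .
    \<comment> \<open>The crude bound \<open>\<pi>\<^sup>2 \<ge> 4\<close> already gives \<open>1 + r - 2 \<pi>\<^sup>2 r\<^sup>2 \<le> 2 - r\<^sup>2 / 2\<close>.\<close>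
    have "pi * pi \<ge> 2 * 2" using pi_ge_two by (intro mult_mono) auto
    then have "pi\<^sup>2 * r\<^sup>2 \<ge> 4 * r\<^sup>2" by (intro mult_right_mono) (auto simp: power2_eq_square)
    moreover have "r \<le> 1 + r\<^sup>2" using zero_le_power2[of "r - 1"] r unfolding power2_eq_square by (simp add: algebra_simps)
    ultimately have "(1 + r) - 2 * pi\<^sup>2 * r\<^sup>2 \<le> 2 - r\<^sup>2 / 2" using zero_le_power2[of r] by linarith
    then have 2: "exp (1 + r) * exp (- 2 * pi\<^sup>2 * r\<^sup>2) \<le> exp 2 * exp (- r\<^sup>2 / 2)"
      by (simp add: exp_add[symmetric])
    have "cmod (fourier gaussian \<xi>) = sqrt (2 * pi) ^ CARD('d) * exp (- 2 * pi\<^sup>2 * r\<^sup>2)"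
      unfolding fourier_gaussian norm_of_real r_def by simp
    then have "(1 + r) powr s * cmod (fourier gaussian \<xi>)
       \<le> (fact N * exp (1 + r)) * (sqrt (2 * pi) ^ CARD('d) * exp (- 2 * pi\<^sup>2 * r\<^sup>2))"
      using 1 by (simp add: mult_right_mono)
    also have "\<dots> = fact N * sqrt (2 * pi) ^ CARD('d) * (exp (1 + r) * exp (- 2 * pi\<^sup>2 * r\<^sup>2))" by simp
    also have "\<dots> \<le> fact N * sqrt (2 * pi) ^ CARD('d) * (exp 2 * exp (- r\<^sup>2 / 2))"
      by (intro mult_left_mono 2) auto
    finally show ?thesis by (simp add: C_def r_def mult_ac)
  qed
  have C: "C \<ge> 0" by (simp add: C_def)
  have "integrable lborel (\<lambda>\<xi>::real ^ 'd. C * norm (gaussian \<xi>))"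
    by (intro integrable_mult_right integrable_norm integrable_gaussian)
  then have int: "integrable lborel (\<lambda>\<xi>::real ^ 'd. C * exp (- (norm \<xi>)\<^sup>2 / 2))"
    by (simp add: gaussian_def del: of_real_exp)
  have "gaussian \<in> extensions \<Omega> gaussian"
    using integrable_gaussian integrable_completion[of gaussian lborel]
    by (auto simp: extensions_def intro!: borel_measurable_continuous_onI continuous_on_gaussian)
  then have "barron_norm s \<Omega> gaussian
     \<le> (\<integral>\<^sup>+ \<xi>. ennreal ((1 + norm \<xi>) powr s * cmod (fourier gaussian (\<xi> :: real ^ 'd))) \<partial>lebesgue)"
    unfolding barron_norm_def by (rule INF_lower)
  also have "\<dots> \<le> (\<integral>\<^sup>+ \<xi>. ennreal (C * exp (- (norm (\<xi> :: real ^ 'd))\<^sup>2 / 2)) \<partial>lebesgue)"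
    by (intro nn_integral_mono ennreal_leI bound)
  also have "\<dots> = (\<integral>\<^sup>+ \<xi>. ennreal (C * exp (- (norm (\<xi> :: real ^ 'd))\<^sup>2 / 2)) \<partial>lborel)"
    by (rule nn_integral_completion)
  also have "\<dots> = ennreal (integral\<^sup>L lborel (\<lambda>\<xi>::real ^ 'd. C * exp (- (norm \<xi>)\<^sup>2 / 2)))"
    using int C by (intro nn_integral_eq_integral) auto
  finally show ?thesis unfolding barron_space_def by (auto simp: less_top[symmetric] top_unique)
qed

text \<open>
  The Hermite polynomials up to sign: the derivative of order \<open>n\<close> of \<open>exp (- t\<^sup>2 / 2)\<close> is
  \<open>hermite n t * exp (- t\<^sup>2 / 2)\<close>.
\<close>

primrec hermite :: "nat \<Rightarrow> real poly" where
  "hermite 0 = 1"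
| "hermite (Suc n) = pderiv (hermite n) - [:0, 1:] * hermite n"

lemma hermite_nonzero: "hermite n \<noteq> 0"
proof -
  have "degree (hermite n) \<le> n \<and> coeff (hermite n) n = (-1) ^ n"
  proof (induction n)
    case (Suc n)
    have "degree (pderiv (hermite n)) \<le> Suc n" using Suc degree_pderiv[of "hermite n"] by linarith
    moreover have "degree ([:0, 1:] * hermite n) \<le> Suc n"
      using Suc degree_mult_le[of "[:0,1:]" "hermite n"] by simp
    ultimately have "degree (hermite (Suc n)) \<le> Suc n" by (simp add: degree_diff_le)
    moreover have "coeff (hermite n) (Suc (Suc n)) = 0" using Suc by (intro coeff_eq_0) simp
    ultimately show ?case using Suc by (simp add: coeff_pderiv)
  qed simp
  then show ?thesis by auto
qed

lemma line_derivative_gaussian: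
  "((\<lambda>t. of_real (poly (hermite l) ((x + t *\<^sub>R axis i 1) $ i)) * gaussian (x + t *\<^sub>R axis i 1))
     has_vector_derivative of_real (poly (hermite (Suc l)) (x $ i)) * gaussian x) (at 0)"
proof -
  have n: "(norm (x + t *\<^sub>R axis i 1))\<^sup>2 = (norm x)\<^sup>2 + 2 * t * x $ i + t\<^sup>2" for t
    unfolding power2_norm_eq_inner
    by (simp add: inner_add_left inner_add_right inner_axis inner_axis' power2_eq_square algebra_simps)
  have "((\<lambda>t. poly (hermite l) (x $ i + t) * exp (- ((norm x)\<^sup>2 + 2 * t * x $ i + t\<^sup>2) / 2))
     has_real_derivative poly (hermite (Suc l)) (x $ i) * exp (- (norm x)\<^sup>2 / 2)) (at 0)"
    by (auto intro!: derivative_eq_intros simp: algebra_simps)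
  from has_vector_derivative_of_real[OF this]
  show ?thesis unfolding gaussian_def n by (simp add: axis_def del: of_real_exp)
qed

text \<open>
  A nonzero polynomial has finitely many roots, hence has constant sign \<open>\<sigma>\<close> and is bounded away from zero on some
  interval inside the unit interval. The cells will subdivide the cube over this interval.
\<close>

lemma hermite_bounded_below:
  obtains a L c \<sigma> where "0 < a" "0 < L" "a + L < 1" "c > 0" "\<bar>\<sigma>\<bar> = (1::real)"
    "\<And>t. t \<in> {a..a + L} \<Longrightarrow> \<sigma> * poly (hermite n) t \<ge> c"
proof -
  have "finite {t. poly (hermite n) t = 0}" by (rule poly_roots_finite[OF hermite_nonzero])
  then have "\<not> {0<..<1} \<subseteq> {t. poly (hermite n) t = 0}"
    using infinite_Ioo[of 0 "1::real"] finite_subset by (metis zero_less_one)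
  then obtain a where "a \<in> {0<..<1}" and p: "poly (hermite n) a \<noteq> 0" by blast
  then have a: "0 < a" "a < 1" by auto
  define \<sigma> where "\<sigma> = sgn (poly (hermite n) a)"
  define c where "c = \<bar>poly (hermite n) a\<bar> / 2"
  have c: "c > 0" "\<sigma> * poly (hermite n) a > c" using p by (auto simp: c_def \<sigma>_def sgn_if)
  have "isCont (\<lambda>t. \<sigma> * poly (hermite n) t) a" by (intro continuous_intros)
  then have "\<forall>\<^sub>F t in nhds a. \<sigma> * poly (hermite n) t > c"
    using c by (intro order_tendstoD(1)[OF tendsto_at_iff_tendsto_nhds[THEN iffD1]]) (auto simp: isCont_def)
  then obtain \<delta> where \<delta>: "\<delta> > 0" "\<And>t. dist t a < \<delta> \<Longrightarrow> \<sigma> * poly (hermite n) t > c"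
    by (auto simp: eventually_nhds_metric)
  define L where "L = min (\<delta> / 2) ((1 - a) / 2)"
  have "0 < L" "a + L < 1" using \<delta> a by (auto simp: L_def min_def field_simps)
  moreover have "\<sigma> * poly (hermite n) t \<ge> c" if "t \<in> {a..a + L}" for t
    using that \<delta>(1) by (intro less_imp_le[OF \<delta>(2)]) (auto simp: L_def dist_real_def)
  moreover have "\<bar>\<sigma>\<bar> = 1" using p by (simp add: \<sigma>_def abs_sgn_eq)
  ultimately show ?thesis using that[of a L c \<sigma>] a c by auto
qed

section \<open>Cells that meet no hyperplane\<close>

definition grid :: "nat \<Rightarrow> ('d::finite \<Rightarrow> nat) set" where
  "grid N = {\<kappa>. \<forall>i. \<kappa> i < N}"

definition corner :: "real \<Rightarrow> real \<Rightarrow> ('d::finite \<Rightarrow> nat) \<Rightarrow> real ^ 'd" where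
  "corner a h \<kappa> = (\<chi> i. a + h * real (\<kappa> i))"

lemma finite_grid: "finite (grid N :: ('d::finite \<Rightarrow> nat) set)" and card_grid: "card (grid N :: ('d::finite \<Rightarrow> nat) set) = N ^ CARD('d)"
proof -
  have eq: "grid N = (PiE UNIV (\<lambda>_. {..<N}) :: ('d \<Rightarrow> nat) set)"
    by (auto simp: grid_def PiE_UNIV_domain)
  show "finite (grid N :: ('d \<Rightarrow> nat) set)" unfolding eq by (intro finite_PiE) auto
  show "card (grid N :: ('d \<Rightarrow> nat) set) = N ^ CARD('d)" unfolding eq by (subst card_PiE) auto
qed

lemma disjoint_cells:
  assumes "h > 0" "\<kappa> \<noteq> \<kappa>'"
  shows "box (corner a h \<kappa>) (corner a h \<kappa> + h *\<^sub>R 1) \<inter> box (corner a h \<kappa>') (corner a h \<kappa>' + h *\<^sub>R 1) = {}"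
proof -
  have *: "\<not> (l < l')" if "a + h * real l < t" "t < a + h * real l + h" "a + h * real l' < t" "t < a + h * real l' + h"
    for l l' :: nat and t
  proof
    assume "l < l'"
    then have "h * (real l + 1) \<le> h * real l'" using assms by (intro mult_left_mono) auto
    then show False using that by (simp add: algebra_simps)
  qed
  obtain i where i: "\<kappa> i < \<kappa>' i \<or> \<kappa>' i < \<kappa> i" using assms by (meson ext linorder_neqE)
  show ?thesis
  proof (rule ccontr)
    assume "\<not> ?thesis"
    then obtain x where "x \<in> box (corner a h \<kappa>) (corner a h \<kappa> + h *\<^sub>R 1)" "x \<in> box (corner a h \<kappa>') (corner a h \<kappa>' + h *\<^sub>R 1)"
      by blast
    then have "a + h * real (\<kappa> i) < x $ i" "x $ i < a + h * real (\<kappa> i) + h"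
       "a + h * real (\<kappa>' i) < x $ i" "x $ i < a + h * real (\<kappa>' i) + h"
      by (auto simp: mem_box_cart corner_def)
    then show False using * i by blast
  qed
qed

text \<open>
  Let \<open>i\<close> be a coordinate in which \<open>|\<omega>\<^sub>i|\<close> is largest. Two points of the hyperplane whose other coordinates
  differ by at most \<open>h\<close> have coordinates \<open>i\<close> that differ by at most \<open>(d - 1) h\<close>. So in each column of cells in
  direction \<open>i\<close> at most \<open>d + 1\<close> cells are crossed, and there are \<open>N\<^sup>d\<^sup>-\<^sup>1\<close> columns. The factor \<open>N\<close> on the
  left avoids the exponent \<open>d - 1\<close>.
\<close>

lemma card_crossed_cells:
  fixes \<omega> :: "real ^ 'd::finite"
  assumes "\<omega> \<noteq> 0" "h > 0"
  shows "card {\<kappa> \<in> grid N. \<exists>x \<in> cbox (corner a h \<kappa>) (corner a h \<kappa> + h *\<^sub>R 1). \<omega> \<bullet> x + b = 0} * N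
           \<le> (CARD('d) + 1) * N ^ CARD('d)"
proof -
  define X where "X = {\<kappa> \<in> grid N. \<exists>x \<in> cbox (corner a h \<kappa>) (corner a h \<kappa> + h *\<^sub>R 1). \<omega> \<bullet> x + b = 0}"
  have "Max (range (\<lambda>i. \<bar>\<omega> $ i\<bar>)) \<in> range (\<lambda>i. \<bar>\<omega> $ i\<bar>)" by (intro Max_in) auto
  then obtain i where i: "\<bar>\<omega> $ i\<bar> = Max (range (\<lambda>i. \<bar>\<omega> $ i\<bar>))" by (metis imageE)
  have max: "\<bar>\<omega> $ l\<bar> \<le> \<bar>\<omega> $ i\<bar>" for l unfolding i by (intro Max_ge) auto
  have pos: "\<bar>\<omega> $ i\<bar> > 0"
  proof (rule ccontr)
    assume "\<not> \<bar>\<omega> $ i\<bar> > 0"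
    then have "\<omega> $ l = 0" for l using max[of l] by simp
    then show False using assms(1) by (simp add: vec_eq_iff)
  qed
  have close: "\<kappa> i \<le> \<kappa>' i + CARD('d)"
    if "\<kappa> \<in> X" "\<kappa>' \<in> X" "\<kappa>(i := 0) = \<kappa>'(i := 0)" for \<kappa> \<kappa>'
  proof -
    obtain x where x: "x \<in> cbox (corner a h \<kappa>) (corner a h \<kappa> + h *\<^sub>R 1)" "\<omega> \<bullet> x + b = 0"
      using \<open>\<kappa> \<in> X\<close> by (auto simp: X_def)
    obtain y where y: "y \<in> cbox (corner a h \<kappa>') (corner a h \<kappa>' + h *\<^sub>R 1)" "\<omega> \<bullet> y + b = 0"
      using \<open>\<kappa>' \<in> X\<close> by (auto simp: X_def)
    have xb: "a + h * real (\<kappa> l) \<le> x $ l \<and> x $ l \<le> a + h * real (\<kappa> l) + h" for l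
      using x by (auto simp: mem_box_cart corner_def)
    have yb: "a + h * real (\<kappa>' l) \<le> y $ l \<and> y $ l \<le> a + h * real (\<kappa>' l) + h" for l
      using y by (auto simp: mem_box_cart corner_def)
    have off: "\<bar>x $ l - y $ l\<bar> \<le> h" if "l \<noteq> i" for l
    proof -
      have "\<kappa> l = \<kappa>' l" using \<open>\<kappa>(i := 0) = \<kappa>'(i := 0)\<close> that by (metis fun_upd_apply)
      then show ?thesis using xb[of l] yb[of l] by (simp add: abs_le_iff)
    qed
    have "0 = (\<Sum>l\<in>UNIV. \<omega> $ l * (x $ l - y $ l))"
      using x(2) y(2) by (simp add: inner_vec_def sum_subtractf right_diff_distrib)
    also have "\<dots> = \<omega> $ i * (x $ i - y $ i) + (\<Sum>l\<in>UNIV - {i}. \<omega> $ l * (x $ l - y $ l))"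
      by (subst sum.remove[of UNIV i]) auto
    finally have "\<omega> $ i * (x $ i - y $ i) = - (\<Sum>l\<in>UNIV - {i}. \<omega> $ l * (x $ l - y $ l))"
      by linarith
    then have "\<bar>\<omega> $ i\<bar> * \<bar>x $ i - y $ i\<bar> = \<bar>\<Sum>l\<in>UNIV - {i}. \<omega> $ l * (x $ l - y $ l)\<bar>"
      by (metis abs_minus_cancel abs_mult)
    also have "\<dots> \<le> (\<Sum>l\<in>UNIV - {i}. \<bar>\<omega> $ i\<bar> * h)"
      using off by (intro order_trans[OF sum_abs] sum_mono) (auto simp: abs_mult intro!: mult_mono max)
    also have "\<dots> = \<bar>\<omega> $ i\<bar> * ((real CARD('d) - 1) * h)"
      by (simp add: card_Diff_singleton of_nat_diff)
    finally have "\<bar>x $ i - y $ i\<bar> \<le> (real CARD('d) - 1) * h" using pos by simp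
    then have "h * (real (\<kappa> i) - real (\<kappa>' i)) \<le> h * real CARD('d)"
      using xb[of i] yb[of i] abs_ge_self[of "x $ i - y $ i"] by (simp add: algebra_simps del: abs_ge_self)
    then have "real (\<kappa> i) - real (\<kappa>' i) \<le> real CARD('d)" using assms(2) by simp
    then show ?thesis by linarith
  qed
  have finX: "finite X" unfolding X_def by (rule finite_subset[OF _ finite_grid]) auto
  define Y where "Y = (\<lambda>\<kappa>. \<kappa>(i := 0)) ` X"
  have fiber: "card {\<kappa> \<in> X. \<kappa>(i := 0) = y} \<le> CARD('d) + 1" if "y \<in> Y" for y
  proof -
    define F where "F = {\<kappa> \<in> X. \<kappa>(i := 0) = y}"
    have "\<exists>\<kappa>. \<kappa> \<in> F" using that by (auto simp: F_def Y_def)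
    then obtain \<kappa>0 where \<kappa>0: "\<kappa>0 \<in> F" "\<And>\<kappa>. \<kappa> \<in> F \<Longrightarrow> \<kappa>0 i \<le> \<kappa> i"
      using ex_has_least_nat[of "\<lambda>\<kappa>. \<kappa> \<in> F" _ "\<lambda>\<kappa>. \<kappa> i"] by blast
    have "inj_on (\<lambda>\<kappa>. \<kappa> i) F"
    proof (rule inj_onI)
      fix \<kappa> \<kappa>' assume "\<kappa> \<in> F" "\<kappa>' \<in> F" "\<kappa> i = \<kappa>' i"
      then have "\<kappa>(i := 0) = \<kappa>'(i := 0)" by (simp add: F_def)
      then show "\<kappa> = \<kappa>'" using \<open>\<kappa> i = \<kappa>' i\<close> by (metis fun_upd_triv fun_upd_upd)
    qed
    moreover have "(\<lambda>\<kappa>. \<kappa> i) ` F \<subseteq> {\<kappa>0 i..\<kappa>0 i + CARD('d)}"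
      using \<kappa>0 close by (auto simp: F_def)
    ultimately have "card F \<le> card {\<kappa>0 i..\<kappa>0 i + CARD('d)}"
      by (metis card_image card_mono finite_atLeastAtMost)
    then show ?thesis by (simp add: F_def)
  qed
  have "X = (\<Union>y\<in>Y. {\<kappa> \<in> X. \<kappa>(i := 0) = y})" by (auto simp: Y_def)
  then have "card X \<le> (\<Sum>y\<in>Y. card {\<kappa> \<in> X. \<kappa>(i := 0) = y})"
    using card_UN_le[of Y "\<lambda>y. {\<kappa> \<in> X. \<kappa>(i := 0) = y}"] finX by (simp add: Y_def)
  also have "\<dots> \<le> (\<Sum>y\<in>Y. CARD('d) + 1)" by (intro sum_mono fiber)
  finally have 1: "card X \<le> (CARD('d) + 1) * card Y" by (simp add: mult.commute)
  have "card (Y \<times> {..<N}) \<le> card (grid N :: ('d \<Rightarrow> nat) set)"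
  proof (rule card_inj_on_le)
    show "inj_on (\<lambda>(y, t). y(i := t)) (Y \<times> {..<N})"
    proof (rule inj_onI, clarify)
      fix y t y' t' assume "y \<in> Y" "y' \<in> Y" and eq: "y(i := t) = y'(i := t')"
      then have "y(i := 0) = y" "y'(i := 0) = y'" by (auto simp: Y_def)
      moreover have "y(i := 0) = y'(i := 0)" using eq by (metis fun_upd_upd)
      moreover have "t = t'" using eq by (metis fun_upd_same)
      ultimately show "y = y' \<and> t = t'" by metis
    qed
    show "(\<lambda>(y, t). y(i := t)) ` (Y \<times> {..<N}) \<subseteq> grid N" by (auto simp: Y_def X_def grid_def)
  qed (rule finite_grid)
  then have 2: "card Y * N \<le> N ^ CARD('d)" by (simp add: card_cartesian_product card_grid)
  have "card X * N \<le> (CARD('d) + 1) * card Y * N" using 1 by (rule mult_le_mono1)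
  also have "\<dots> \<le> (CARD('d) + 1) * N ^ CARD('d)" using 2 by (simp only: mult.assoc mult_le_mono2)
  finally show ?thesis by (simp add: X_def)
qed

text \<open>
  The \<open>n\<close> hyperplanes together cross at most \<open>n (d + 1) N\<^sup>d\<^sup>-\<^sup>1 = N\<^sup>d / 2\<close> cells.
\<close>

lemma many_uncrossed_cells:
  fixes \<omega> :: "nat \<Rightarrow> real ^ 'd::finite" and a h :: real and b :: "nat \<Rightarrow> real"
  assumes \<omega>: "\<And>i. i < n \<Longrightarrow> \<omega> i \<noteq> 0" and h: "h > 0" and n: "n \<ge> 1"
    and N: "N = 2 * (CARD('d) + 1) * n"
  defines "G \<equiv> {\<kappa> \<in> grid N. \<forall>i<n. \<forall>x \<in> cbox (corner a h \<kappa>) (corner a h \<kappa> + h *\<^sub>R 1). \<omega> i \<bullet> x + b i \<noteq> 0}"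
  shows "N ^ CARD('d) \<le> 2 * card G"
proof -
  define X where "X i = {\<kappa> \<in> grid N. \<exists>x \<in> cbox (corner a h \<kappa>) (corner a h \<kappa> + h *\<^sub>R 1). \<omega> i \<bullet> x + b i = 0}" for i
  have "grid N = G \<union> (\<Union>i<n. X i)" by (auto simp: G_def X_def)
  then have "card (grid N :: ('d \<Rightarrow> nat) set) \<le> card G + card (\<Union>i<n. X i)" by (simp add: card_Un_le)
  also have "\<dots> \<le> card G + (\<Sum>i<n. card (X i))" by (simp add: card_UN_le)
  finally have "N ^ CARD('d) * N \<le> (card G + (\<Sum>i<n. card (X i))) * N"
    unfolding card_grid by (rule mult_le_mono1)
  also have "\<dots> = card G * N + (\<Sum>i<n. card (X i) * N)" by (simp only: distrib_right sum_distrib_right)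
  also have "\<dots> \<le> card G * N + (\<Sum>i<n. (CARD('d) + 1) * N ^ CARD('d))"
    unfolding X_def using \<omega> h by (intro add_left_mono sum_mono card_crossed_cells) auto
  finally have "2 * (N ^ CARD('d) * N) \<le> 2 * card G * N + N * N ^ CARD('d)"
    by (simp add: N algebra_simps)
  then have "N ^ CARD('d) * N \<le> 2 * card G * N" by (simp add: algebra_simps)
  then show ?thesis using n by (simp add: N)
qed

section \<open>Duality estimates on an uncrossed cell\<close>

text \<open>
  An affine function without a zero on a convex set has constant sign there, so the neuron is either the full power
  (\<open>\<epsilon> = 1\<close>) or zero (\<open>\<epsilon> = 0\<close>).
\<close>

lemma relu_pow_eq_power_on_uncrossed:
  fixes \<omega> :: "real ^ 'd::finite"
  assumes "convex Q" "\<And>x. x \<in> Q \<Longrightarrow> \<omega> \<bullet> x + b \<noteq> 0"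
  obtains \<epsilon> where "\<And>x. x \<in> Q \<Longrightarrow> relu_pow k (\<omega> \<bullet> x + b) = \<epsilon> * (\<omega> \<bullet> x + b) ^ k"
proof (cases "\<exists>y \<in> Q. \<omega> \<bullet> y + b > 0")
  case True
  then obtain y where y: "y \<in> Q" "\<omega> \<bullet> y + b > 0" by auto
  have "\<omega> \<bullet> x + b > 0" if "x \<in> Q" for x
  proof (rule ccontr)
    assume "\<not> ?thesis"
    then have "\<exists>z\<in>Q. \<omega> \<bullet> z = - b"
      using convex_connected[OF assms(1)] \<open>x \<in> Q\<close> y
      by (intro connected_ivt_hyperplane[of Q x y \<omega> "- b"]) auto
    then show False using assms(2) by force
  qed
  then have "relu_pow k (\<omega> \<bullet> x + b) = 1 * (\<omega> \<bullet> x + b) ^ k" if "x \<in> Q" for x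
    using that by (force simp: relu_pow_def max_def)
  then show ?thesis by (rule that)
next
  case False
  then have "relu_pow k (\<omega> \<bullet> x + b) = 0 * (\<omega> \<bullet> x + b) ^ k" if "x \<in> Q" for x
    using that by (auto simp: relu_pow_def not_less max_def power_0_left)
  then show ?thesis by (rule that)
qed

text \<open>
  The derivative of order \<open>l\<close> of a ridge power, with the falling factorial written as a product of truncated
  differences: it acquires the factor \<open>k - k = 0\<close> at \<open>l = k + 1\<close>, so the same formula covers the derivative
  that vanishes.
\<close>

lemma line_derivative_ridge_power:
  fixes \<omega> :: "real ^ 'd::finite"
  shows "((\<lambda>t. of_real ((\<Prod>q<l. real (k - q)) * (\<omega> $ i) ^ l * (\<omega> \<bullet> (x + t *\<^sub>R axis i 1) + b) ^ (k - l)) :: complex)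
     has_vector_derivative of_real ((\<Prod>q<Suc l. real (k - q)) * (\<omega> $ i) ^ Suc l * (\<omega> \<bullet> x + b) ^ (k - Suc l))) (at 0)"
proof -
  define P where "P = (\<Prod>q<l. real (k - q))"
  have PS: "(\<Prod>q<Suc l. real (k - q)) = P * real (k - l)" by (simp add: P_def)
  have "((\<lambda>t. P * (\<omega> $ i) ^ l * (\<omega> \<bullet> x + t * \<omega> $ i + b) ^ (k - l))
     has_real_derivative P * real (k - l) * (\<omega> $ i) ^ Suc l * (\<omega> \<bullet> x + b) ^ (k - Suc l)) (at 0)"
    by (auto intro!: derivative_eq_intros)
  from has_vector_derivative_of_real[OF this] show ?thesis
    unfolding PS P_def[symmetric] by (simp only: inner_add_right inner_scaleR_right inner_axis) simp
qed

lemma integral_ridge_power_cell_bump_eq_0: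
  fixes \<omega> :: "real ^ 'd::finite"
  assumes "h > 0"
  shows "integral\<^sup>L lborel (\<lambda>x. of_real ((\<omega> \<bullet> x + b) ^ k) * cell_bump z h (\<lambda>l. if l = i then Suc k else 0) x) = 0"
proof -
  define u where "u = (\<lambda>l x. complex_of_real ((\<Prod>q<l. real (k - q)) * (\<omega> $ i) ^ l * (\<omega> \<bullet> x + b) ^ (k - l)))"
  have "integral\<^sup>L lborel (\<lambda>x. u 0 x * cell_bump z h (\<lambda>l. if l = i then Suc k else 0) x)
      = (-1) ^ Suc k * integral\<^sup>L lborel (\<lambda>x. u (Suc k) x * cell_bump z h (\<lambda>_. 0) x)"
    by (rule integral_by_parts_cell_bump[OF assms])
       (unfold u_def, intro continuous_intros, rule line_derivative_ridge_power)
  then show ?thesis by (simp add: u_def)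
qed

lemma integral_const_cell_bump_eq_0:
  assumes "h > 0" "r > 0"
  shows "integral\<^sup>L lborel (\<lambda>x. w * cell_bump z h (\<lambda>l. if l = i then r else 0) x) = 0"
  using integral_by_parts_cell_bump[OF assms(1), of r "\<lambda>l x. if l = 0 then w else 0" i z] assms(2)
  by (simp add: continuous_intros)

text \<open>
  Moving all derivatives from the bump to the Gaussian turns the integral into that of
  \<open>hermite p x\<^sub>i * exp (- |x|\<^sup>2 / 2)\<close> against a nonnegative bump. The first factor is at least \<open>c\<close> in modulus and
  has the sign \<open>\<sigma>\<close>, the second is at least \<open>exp (- d / 2)\<close> on the unit cube, and the bump has a definite height on a
  concentric cube of volume \<open>(h / 2)\<^sup>d\<close>.
\<close>

lemma gaussian_cell_integral_lower_bound:
  fixes i :: "'d::finite"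
  assumes c: "c > 0" and \<sigma>: "\<bar>\<sigma>\<bar> = (1::real)" and aL: "0 \<le> a" "a + L \<le> 1"
    and H: "\<And>t. t \<in> {a..a + L} \<Longrightarrow> \<sigma> * poly (hermite p) t \<ge> c"
    and h: "h > 0" and cell: "\<And>x l. x \<in> cbox z (z + h *\<^sub>R 1) \<Longrightarrow> x $ l \<in> {a..a + L}"
  shows "norm (integral\<^sup>L lborel (\<lambda>x. gaussian x * cell_bump z h (\<lambda>l. if l = i then p else 0) x))
    \<ge> c * exp (- real CARD('d) / 2) * exp (- (16 / 3)) ^ CARD('d) / 2 ^ CARD('d) * h ^ CARD('d)"
proof -
  define \<beta> where "\<beta> x = (\<Prod>l\<in>UNIV. bump_deriv 0 ((x $ l - z $ l) / h))" for x :: "real ^ 'd"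
  define E where "E = c * exp (- real CARD('d) / 2) * exp (- (16 / 3)) ^ CARD('d)"
  define R where "R x = \<sigma> * (poly (hermite p) (x $ i) * exp (- (norm x)\<^sup>2 / 2) * \<beta> x)" for x :: "real ^ 'd"
  define Q where "Q = cbox (z + (h/4) *\<^sub>R 1) (z + (3*h/4) *\<^sub>R 1)"
  have cb: "cell_bump z h (\<lambda>_. 0) x = of_real (\<beta> x)" for x by (simp add: cell_bump_def \<beta>_def)
  have "integral\<^sup>L lborel (\<lambda>x. gaussian x * cell_bump z h (\<lambda>l. if l = i then p else 0) x)
      = (-1) ^ p * integral\<^sup>L lborel (\<lambda>x. of_real (poly (hermite p) (x $ i)) * gaussian x * cell_bump z h (\<lambda>_. 0) x)"
  proof -
    define u where "u = (\<lambda>l (x :: real ^ 'd). of_real (poly (hermite l) (x $ i)) * gaussian x)"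
    have "integral\<^sup>L lborel (\<lambda>x. u 0 x * cell_bump z h (\<lambda>l. if l = i then p else 0) x)
        = (-1) ^ p * integral\<^sup>L lborel (\<lambda>x. u p x * cell_bump z h (\<lambda>_. 0) x)"
      by (rule integral_by_parts_cell_bump[OF h])
         (unfold u_def, intro continuous_intros continuous_on_gaussian, rule line_derivative_gaussian)
    then show ?thesis by (simp add: u_def)
  qed
  also have "(\<lambda>x. of_real (poly (hermite p) (x $ i)) * gaussian x * cell_bump z h (\<lambda>_. 0) x) = (\<lambda>x. of_real \<sigma> * of_real (R x))"
  proof -
    have "\<sigma> * \<sigma> = 1" using \<sigma> by (metis abs_mult_self_eq mult_1)
    then have "poly (hermite p) (x $ i) * exp (- (norm x)\<^sup>2 / 2) * \<beta> x = \<sigma> * R x" for x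
      by (simp add: R_def mult.assoc[symmetric])
    then show ?thesis by (simp only: cb gaussian_def of_real_mult[symmetric])
  qed
  finally have eq: "norm (integral\<^sup>L lborel (\<lambda>x. gaussian x * cell_bump z h (\<lambda>l. if l = i then p else 0) x))
      = \<bar>integral\<^sup>L lborel R\<bar>"
    using \<sigma> by (simp add: norm_mult norm_power)
  have "integrable lborel (\<lambda>x. complex_of_real (\<sigma> * poly (hermite p) (x $ i) * exp (- (norm x)\<^sup>2 / 2)) * cell_bump z h (\<lambda>_. 0) x)"
    by (intro integrable_mult_cell_bump h continuous_intros continuous_on_component) auto
  moreover have "(\<lambda>x. complex_of_real (\<sigma> * poly (hermite p) (x $ i) * exp (- (norm x)\<^sup>2 / 2)) * cell_bump z h (\<lambda>_. 0) x)
     = (\<lambda>x. complex_of_real (R x))"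
    by (simp add: fun_eq_iff cb R_def)
  ultimately have intR: "integrable lborel R" by (simp add: complex_of_real_integrable_eq)
  have Qsub: "Q \<subseteq> box z (z + h *\<^sub>R 1)"
  proof
    fix x assume "x \<in> Q"
    then have *: "z $ l + h / 4 \<le> x $ l \<and> x $ l \<le> z $ l + 3 * h / 4" for l by (simp add: Q_def mem_box_cart)
    have "z $ l < x $ l \<and> x $ l < z $ l + h" for l using *[of l] h by linarith
    then show "x \<in> box z (z + h *\<^sub>R 1)" by (simp add: mem_box_cart)
  qed
  have \<beta>0: "\<beta> x \<ge> 0" for x unfolding \<beta>_def by (intro prod_nonneg) (simp add: bump_deriv_def)
  have lower: "indicator Q x * E \<le> R x" for x
  proof (cases "x \<in> box z (z + h *\<^sub>R 1)")
    case True
    then have xl: "x $ l \<in> {a..a + L}" for l using cell box_subset_cbox by blast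
    have "(norm x)\<^sup>2 = (\<Sum>l\<in>UNIV. (x $ l)\<^sup>2)" by (simp add: norm_vec_def L2_set_def sum_nonneg)
    also have "\<dots> \<le> (\<Sum>l\<in>(UNIV :: 'd set). 1)"
    proof (rule sum_mono)
      fix l show "(x $ l)\<^sup>2 \<le> 1" using xl[of l] aL by (simp add: power_le_one)
    qed
    finally have "(norm x)\<^sup>2 \<le> real CARD('d)" by simp
    then have e: "exp (- real CARD('d) / 2) \<le> exp (- (norm x)\<^sup>2 / 2)" by simp
    have "c * exp (- real CARD('d) / 2) \<le> \<sigma> * poly (hermite p) (x $ i) * exp (- (norm x)\<^sup>2 / 2)"
      using H[OF xl[of i]] e c by (intro mult_mono) auto
    then have "c * exp (- real CARD('d) / 2) * \<beta> x \<le> R x"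
      using \<beta>0[of x] by (auto simp: R_def mult.assoc[symmetric] intro!: mult_right_mono)
    moreover have "indicator Q x * E \<le> c * exp (- real CARD('d) / 2) * \<beta> x"
    proof (cases "x \<in> Q")
      case True
      then show ?thesis using cell_bump_lower[OF h, of x z] c
        unfolding Q_def[symmetric] by (auto simp: E_def \<beta>_def intro!: mult_left_mono)
    qed (use c \<beta>0 in auto)
    ultimately show ?thesis by simp
  next
    case False
    then have "\<beta> x = 0" using cell_bump_eq_0[OF h False, of "\<lambda>_. 0"] cb[of x] by simp
    moreover have "x \<notin> Q" using False Qsub by auto
    ultimately show ?thesis by (simp add: R_def)
  qed
  have mQ: "measure lborel Q = (h / 2) ^ CARD('d)"
  proof -
    have "measure lborel Q = (\<Prod>l\<in>(UNIV :: 'd set). h / 2)"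
      unfolding Q_def using h by (subst content_cbox_cart) (auto simp: interval_eq_empty_cart field_simps intro!: prod.cong)
    then show ?thesis by simp
  qed
  have "E * (h / 2) ^ CARD('d) = integral\<^sup>L lborel (\<lambda>x. indicator Q x * E)"
    unfolding mQ[symmetric] by (simp add: Q_def)
  also have "\<dots> \<le> integral\<^sup>L lborel R"
    by (intro integral_mono intR lower integrable_mult_left integrable_real_indicator)
       (auto simp: Q_def emeasure_lborel_cbox_finite less_top[symmetric] emeasure_lborel_cbox_eq)
  also have "\<dots> \<le> \<bar>integral\<^sup>L lborel R\<bar>" by simp
  finally show ?thesis unfolding eq by (simp add: E_def power_divide)
qed

text \<open>
  This is Cauchy--Schwarz, \<open>A\<^sup>2 \<le> \<parallel>g\<parallel>\<^sup>2 \<parallel>\<phi>\<parallel>\<^sup>2\<close> with \<open>\<parallel>\<phi>\<parallel>\<^sup>2 \<le> b\<^sup>2 m\<close>, obtained by integrating the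
  pointwise inequality \<open>|g| b \<le> |g|\<^sup>2 / (2 \<tau>) + \<tau> b\<^sup>2 / 2\<close>. This form allows the square integral of \<open>g\<close> to be infinite.
\<close>

lemma L2_lower_bound_by_duality:
  fixes g \<phi> :: "'a \<Rightarrow> complex"
  assumes B: "B \<in> sets M" "emeasure M B = ennreal m" "m > 0"
    and meas: "(\<lambda>x. indicator B x *\<^sub>R g x) \<in> borel_measurable M"
    and \<phi>0: "\<And>x. x \<notin> B \<Longrightarrow> \<phi> x = 0" and \<phi>b: "\<And>x. norm (\<phi> x) \<le> b" and b: "b > 0"
    and A: "A > 0" "A \<le> norm (integral\<^sup>L M (\<lambda>x. g x * \<phi> x))"
  shows "(\<integral>\<^sup>+x\<in>B. ennreal ((norm (g x))\<^sup>2) \<partial>M) \<ge> ennreal (A\<^sup>2 / (b\<^sup>2 * m))"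
proof -
  \<comment> \<open>With this \<open>\<tau>\<close> the term \<open>\<tau> b\<^sup>2 / 2\<close> integrates to \<open>A / 2\<close> over \<open>B\<close>.\<close>
  define \<tau> where "\<tau> = A / (b\<^sup>2 * m)"
  have \<tau>: "\<tau> > 0" using A b B by (simp add: \<tau>_def)
  have pt: "norm (g x * \<phi> x) \<le> (norm (g x))\<^sup>2 / (2 * \<tau>) + \<tau> * b\<^sup>2 / 2" for x
  proof -
    have "0 \<le> (norm (g x) - \<tau> * b)\<^sup>2" by simp
    then have "norm (g x) * b \<le> (norm (g x))\<^sup>2 / (2 * \<tau>) + \<tau> * b\<^sup>2 / 2"
      using \<tau> by (simp add: field_simps power2_eq_square)
    moreover have "norm (g x * \<phi> x) \<le> norm (g x) * b"
      unfolding norm_mult by (intro mult_left_mono \<phi>b) simp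
    ultimately show ?thesis by linarith
  qed
  have m2: "(\<lambda>x. ennreal ((norm (g x))\<^sup>2) * indicator B x) \<in> borel_measurable M"
  proof -
    have "(\<lambda>x. ennreal ((norm (g x))\<^sup>2) * indicator B x) = (\<lambda>x. ennreal ((norm (indicator B x *\<^sub>R g x))\<^sup>2))"
      by (auto simp: indicator_def)
    then show ?thesis using meas by (simp del: norm_scaleR)
  qed
  have int: "integrable M (\<lambda>x. g x * \<phi> x)"
    using A not_integrable_integral_eq by fastforce
  have "ennreal A \<le> ennreal (norm (integral\<^sup>L M (\<lambda>x. g x * \<phi> x)))" using A by (simp add: ennreal_leI)
  also have "\<dots> \<le> (\<integral>\<^sup>+x. ennreal (norm (g x * \<phi> x)) \<partial>M)"
    by (rule integral_norm_bound_ennreal[OF int])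
  also have "\<dots> \<le> (\<integral>\<^sup>+x. ennreal (1 / (2 * \<tau>)) * (ennreal ((norm (g x))\<^sup>2) * indicator B x) + ennreal (\<tau> * b\<^sup>2 / 2) * indicator B x \<partial>M)"
  proof (intro nn_integral_mono)
    fix x
    show "ennreal (norm (g x * \<phi> x)) \<le> ennreal (1 / (2 * \<tau>)) * (ennreal ((norm (g x))\<^sup>2) * indicator B x) + ennreal (\<tau> * b\<^sup>2 / 2) * indicator B x"
    proof (cases "x \<in> B")
      case True
      have "ennreal (norm (g x * \<phi> x)) \<le> ennreal ((norm (g x))\<^sup>2 / (2 * \<tau>) + \<tau> * b\<^sup>2 / 2)"
        by (intro ennreal_leI pt)
      also have "\<dots> = ennreal (1 / (2 * \<tau>)) * ennreal ((norm (g x))\<^sup>2) + ennreal (\<tau> * b\<^sup>2 / 2)"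
        using \<tau> by (simp add: ennreal_plus ennreal_mult[symmetric])
      finally show ?thesis using True by simp
    qed (simp add: \<phi>0)
  qed
  also have "\<dots> = ennreal (1 / (2 * \<tau>)) * (\<integral>\<^sup>+x\<in>B. ennreal ((norm (g x))\<^sup>2) \<partial>M) + ennreal (\<tau> * b\<^sup>2 / 2) * ennreal m"
    using m2 B by (simp add: nn_integral_add nn_integral_cmult)
  also have "ennreal (\<tau> * b\<^sup>2 / 2) * ennreal m = ennreal (A / 2)"
    using A b B by (subst ennreal_mult[symmetric]) (auto simp: \<tau>_def)
  finally have main: "ennreal A \<le> ennreal (1 / (2 * \<tau>)) * (\<integral>\<^sup>+x\<in>B. ennreal ((norm (g x))\<^sup>2) \<partial>M) + ennreal (A / 2)" .
  show ?thesis
  proof (cases "(\<integral>\<^sup>+x\<in>B. ennreal ((norm (g x))\<^sup>2) \<partial>M)")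
    case (real I)
    have "ennreal A \<le> ennreal (I / (2 * \<tau>) + A / 2)"
      using main real \<tau> A by (subst ennreal_plus) (auto simp: ennreal_mult[symmetric])
    moreover have "0 \<le> I / (2 * \<tau>) + A / 2" using real \<tau> A by simp
    ultimately have "A \<le> I / (2 * \<tau>) + A / 2" by (simp only: ennreal_le_iff)
    then have "\<tau> * A \<le> I" using \<tau> by (simp add: field_simps)
    then show ?thesis using real by (simp add: \<tau>_def power2_eq_square ennreal_leI)
  qed simp
qed

text \<open>
  By the definition of the weak derivative, the \<open>j\<close> derivatives on \<open>f - f\<^sub>n\<close> pass to the bump, which then
  carries \<open>k + 1\<close> of them. On the uncrossed cell \<open>f\<^sub>n\<close> is a sum of ridge powers of degree \<open>k\<close>, and these integrate to
  zero against \<open>\<partial>\<^sub>i\<^sup>k\<^sup>+\<^sup>1 \<psi>\<close>.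
\<close>

lemma integral_weak_derivative_cell_bump:
  fixes \<omega> :: "nat \<Rightarrow> real ^ 'd::finite" and i :: 'd
  assumes h: "h > 0" and j: "j \<le> Suc k" and U: "cbox z (z + h *\<^sub>R 1) \<subseteq> U"
    and uncrossed: "\<And>m x. m < n \<Longrightarrow> x \<in> cbox z (z + h *\<^sub>R 1) \<Longrightarrow> \<omega> m \<bullet> x + b m \<noteq> 0"
    and g: "is_weak_deriv U (\<lambda>l. if l = i then j else 0)
              (\<lambda>x. gaussian x - (\<Sum>m<n. a m * of_real (relu_pow k (\<omega> m \<bullet> x + b m)))) g"
  shows "norm (LINT x|lebesgue. g x * cell_bump z h (\<lambda>l. if l = i then Suc k - j else 0) x)
       = norm (LINT x|lborel. gaussian x * cell_bump z h (\<lambda>l. if l = i then Suc k else 0) x)"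
proof -
  define F where "F x = gaussian x - (\<Sum>m<n. a m * of_real (relu_pow k (\<omega> m \<bullet> x + b m)))" for x
  define \<phi> where "\<phi> = cell_bump z h (\<lambda>l. if l = i then Suc k - j else 0)"
  define \<psi> where "\<psi> = cell_bump z h (\<lambda>l. if l = i then Suc k else 0)"
  have "\<exists>\<epsilon>. \<forall>x\<in>cbox z (z + h *\<^sub>R 1). relu_pow k (\<omega> m \<bullet> x + b m) = \<epsilon> * (\<omega> m \<bullet> x + b m) ^ k" if "m < n" for m
    by (rule relu_pow_eq_power_on_uncrossed[OF convex_box(1) uncrossed[OF that]]) blast+
  then have "\<forall>m. \<exists>\<epsilon>. m < n \<longrightarrow> (\<forall>x\<in>cbox z (z + h *\<^sub>R 1). relu_pow k (\<omega> m \<bullet> x + b m) = \<epsilon> * (\<omega> m \<bullet> x + b m) ^ k)"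
    by blast
  from choice[OF this] obtain \<epsilon> where \<epsilon>: "\<And>m x. m < n \<Longrightarrow> x \<in> cbox z (z + h *\<^sub>R 1)
      \<Longrightarrow> relu_pow k (\<omega> m \<bullet> x + b m) = \<epsilon> m * (\<omega> m \<bullet> x + b m) ^ k" by blast
  have off: "cell_bump z h \<alpha> x = 0" if "x \<notin> U" for \<alpha> x
    using that U box_subset_cbox cell_bump_eq_0[OF h] by blast
  have mp: "multi_partial (\<lambda>l. if l = i then j else 0) \<phi> = \<psi>"
    unfolding multi_partial_single \<phi>_def \<psi>_def partial_power_cell_bump
    using j by (intro arg_cong[where f = "cell_bump z h"]) auto
  have \<phi>: "\<phi> \<in> test_functions U" unfolding \<phi>_def by (rule cell_bump_test_function[OF h U])
  have "\<forall>\<phi>\<in>test_functions U. (LINT x:U|lebesgue. F x * multi_partial (\<lambda>l. if l = i then j else 0) \<phi> x)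
      = (- 1) ^ order_mi (\<lambda>l. if l = i then j else 0) * (LINT x:U|lebesgue. g x * \<phi> x)"
    using g unfolding is_weak_deriv_def F_def by blast
  from bspec[OF this \<phi>] have "(LINT x:U|lebesgue. F x * \<psi> x)
      = (- 1) ^ order_mi (\<lambda>l. if l = i then j else 0) * (LINT x:U|lebesgue. g x * \<phi> x)"
    unfolding mp .
  moreover have "(LINT x:U|lebesgue. F x * \<psi> x) = (LINT x|lebesgue. F x * \<psi> x)"
    "(LINT x:U|lebesgue. g x * \<phi> x) = (LINT x|lebesgue. g x * \<phi> x)"
    unfolding set_lebesgue_integral_def
    by (auto intro!: Bochner_Integration.integral_cong simp: indicator_def off \<phi>_def \<psi>_def)
  ultimately have 1: "norm (LINT x|lebesgue. g x * \<phi> x) = norm (LINT x|lebesgue. F x * \<psi> x)"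
    by (simp add: norm_mult norm_power)
  define P where "P m x = a m * of_real (\<epsilon> m) * (of_real ((\<omega> m \<bullet> x + b m) ^ k) * \<psi> x)" for m x
  have "F x * \<psi> x = gaussian x * \<psi> x - (\<Sum>m<n. P m x)" for x
  proof (cases "x \<in> cbox z (z + h *\<^sub>R 1)")
    case True
    then have "F x = gaussian x - (\<Sum>m<n. a m * of_real (\<epsilon> m * (\<omega> m \<bullet> x + b m) ^ k))"
      unfolding F_def using \<epsilon> by simp
    then show ?thesis by (simp add: P_def left_diff_distrib sum_distrib_right mult.assoc)
  next
    case False
    then have "\<psi> x = 0" unfolding \<psi>_def using cell_bump_eq_0[OF h] box_subset_cbox by blast
    then show ?thesis by (simp add: P_def)
  qed
  then have "(LINT x|lebesgue. F x * \<psi> x) = (LINT x|lebesgue. gaussian x * \<psi> x - (\<Sum>m<n. P m x))"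
    by simp
  also have "\<dots> = (LINT x|lborel. gaussian x * \<psi> x - (\<Sum>m<n. P m x))"
  proof (rule integral_completion)
    have "continuous_on UNIV (\<lambda>x. gaussian x * \<psi> x - (\<Sum>m<n. P m x))"
      unfolding P_def \<psi>_def by (intro continuous_intros continuous_on_gaussian continuous_on_cell_bump)
    then show "(\<lambda>x. gaussian x * \<psi> x - (\<Sum>m<n. P m x)) \<in> borel_measurable lborel"
      by (simp add: borel_measurable_continuous_onI)
  qed
  also have "\<dots> = (LINT x|lborel. gaussian x * \<psi> x) - (\<Sum>m<n. LINT x|lborel. P m x)"
  proof -
    have "integrable lborel (\<lambda>x. gaussian x * \<psi> x)"
      unfolding \<psi>_def by (intro integrable_mult_cell_bump h continuous_on_gaussian)
    moreover have "integrable lborel (P m)" for m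
      unfolding P_def \<psi>_def by (intro integrable_mult_right integrable_mult_cell_bump h continuous_intros)
    ultimately show ?thesis by simp
  qed
  also have "(\<Sum>m<n. LINT x|lborel. P m x) = 0"
  proof (rule sum.neutral, rule ballI)
    fix m
    show "(LINT x|lborel. P m x) = 0"
      unfolding P_def \<psi>_def by (subst integral_mult_right_zero, subst integral_ridge_power_cell_bump_eq_0[OF h]) simp
  qed
  finally show ?thesis using 1 by (simp add: \<phi>_def \<psi>_def)
qed

lemma locally_integrable_on_measurable_on_box:
  fixes g :: "real ^ 'd::finite \<Rightarrow> complex"
  assumes "locally_integrable_on U g" "cbox p q \<subseteq> U"
  shows "(\<lambda>x. indicator (box p q) x *\<^sub>R (g x - w)) \<in> borel_measurable lebesgue"
    and "(\<lambda>x. ennreal ((cmod (g x - w))\<^sup>2) * indicator (box p q) x) \<in> borel_measurable lebesgue"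
proof -
  have "set_integrable lebesgue (cbox p q) g"
    using assms compact_cbox unfolding locally_integrable_on_def by blast
  then have "(\<lambda>x. indicator (cbox p q) x *\<^sub>R g x) \<in> borel_measurable lebesgue"
    unfolding set_integrable_def by (rule borel_measurable_integrable)
  moreover define g' where "g' = (\<lambda>x. indicator (cbox p q) x *\<^sub>R g x)"
  ultimately have [measurable]: "g' \<in> borel_measurable lebesgue" by simp
  have "(\<lambda>x. indicator (box p q) x *\<^sub>R (g' x - w)) \<in> borel_measurable lebesgue"
    by (intro borel_measurable_scaleR borel_measurable_indicator borel_measurable_diff) auto
  moreover have "(\<lambda>x. indicator (box p q) x *\<^sub>R (g' x - w)) = (\<lambda>x. indicator (box p q) x *\<^sub>R (g x - w))"
    using box_subset_cbox[of p q] by (auto simp: indicator_def fun_eq_iff g'_def)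
  ultimately show *: "(\<lambda>x. indicator (box p q) x *\<^sub>R (g x - w)) \<in> borel_measurable lebesgue" by simp
  have "(\<lambda>x. ennreal ((cmod (g x - w))\<^sup>2) * indicator (box p q) x)
      = (\<lambda>x. ennreal ((cmod (indicator (box p q) x *\<^sub>R (g x - w)))\<^sup>2))"
    by (auto simp: indicator_def)
  then show "(\<lambda>x. ennreal ((cmod (g x - w))\<^sup>2) * indicator (box p q) x) \<in> borel_measurable lebesgue"
    using * by (simp del: norm_scaleR)
qed

lemma emeasure_cell:
  "h > 0 \<Longrightarrow> emeasure lebesgue (box z (z + h *\<^sub>R 1) :: (real ^ 'd::finite) set) = ennreal (h ^ CARD('d))"
proof -
  assume h: "h > 0"
  have "measure lborel (cbox z (z + h *\<^sub>R 1) :: (real ^ 'd) set) = (\<Prod>l\<in>(UNIV :: 'd set). h)"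
    using h by (subst content_cbox_cart) (auto simp: interval_eq_empty_cart intro!: prod.cong)
  then have m: "measure lborel (box z (z + h *\<^sub>R 1) :: (real ^ 'd) set) = h ^ CARD('d)"
    by (simp add: measure_lborel_box_eq measure_lborel_cbox_eq)
  have "emeasure lebesgue (box z (z + h *\<^sub>R 1)) = emeasure lborel (box z (z + h *\<^sub>R 1))" by simp
  also have "\<dots> = ennreal (measure lborel (box z (z + h *\<^sub>R 1)))"
    by (rule emeasure_eq_ennreal_measure) (use emeasure_lborel_box_finite[of z] in \<open>simp add: less_top\<close>)
  finally show ?thesis unfolding m .
qed

text \<open>
  The core estimate, with constants independent of the cell, of the network and of the chosen weak derivative. The
  constant \<open>w\<close> prepares the Slobodeckij seminorm: it is invisible to the test function \<open>\<partial>\<^sub>i\<^sup>r \<psi>\<close>, which has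
  integral zero, as soon as \<open>r = k + 1 - j\<close> is positive.
\<close>

lemma weak_derivative_cell_lower_bound:
  fixes i :: "'d::finite"
  assumes j: "j \<le> Suc k"
  obtains a L C where "0 < a" "0 < L" "a + L < 1" "C > 0"
    "\<And>z h (n :: nat) v \<omega> b g w. h > 0
      \<Longrightarrow> (\<And>x l. x \<in> cbox z (z + h *\<^sub>R 1) \<Longrightarrow> x $ l \<in> {a..a + L})
      \<Longrightarrow> (\<And>m x. m < n \<Longrightarrow> x \<in> cbox z (z + h *\<^sub>R 1) \<Longrightarrow> \<omega> m \<bullet> x + b m \<noteq> 0)
      \<Longrightarrow> is_weak_deriv (box 0 1) (\<lambda>l. if l = i then j else 0)
            (\<lambda>x. gaussian x - (\<Sum>m<n. v m * of_real (relu_pow k (\<omega> m \<bullet> x + b m)))) g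
      \<Longrightarrow> (j = Suc k \<Longrightarrow> w = 0)
      \<Longrightarrow> ennreal (C * h ^ (CARD('d) + 2 * (Suc k - j)))
            \<le> (\<integral>\<^sup>+x\<in>box z (z + h *\<^sub>R 1). ennreal ((cmod (g x - w))\<^sup>2) \<partial>lebesgue)"
proof -
  define r where "r = Suc k - j"
  obtain a L c \<sigma> where aL: "0 < a" "0 < L" "a + L < 1" and c: "c > 0" and \<sigma>: "\<bar>\<sigma>\<bar> = (1::real)"
    and H: "\<And>t. t \<in> {a..a + L} \<Longrightarrow> \<sigma> * poly (hermite (Suc k)) t \<ge> c"
    using hermite_bounded_below[of "Suc k"] by blast
  obtain M where M: "M > 0" "\<And>z h x. h > 0 \<Longrightarrow> norm (cell_bump z h (\<lambda>l. if l = i then r else 0) x) \<le> M / h ^ r"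
    using norm_cell_bump_le[of i r] by blast
  define E where "E = c * exp (- real CARD('d) / 2) * exp (- (16 / 3)) ^ CARD('d) / 2 ^ CARD('d)"
  have E: "E > 0" using c by (simp add: E_def)
  show ?thesis
  proof (rule that[OF aL])
    show "(E / M)\<^sup>2 > 0" using E M by simp
    fix z :: "real ^ 'd" and h :: real and n and v :: "nat \<Rightarrow> complex" and \<omega> :: "nat \<Rightarrow> real ^ 'd"
      and b :: "nat \<Rightarrow> real" and g :: "real ^ 'd \<Rightarrow> complex" and w :: complex
    assume h: "h > 0" and cell: "\<And>x l. x \<in> cbox z (z + h *\<^sub>R 1) \<Longrightarrow> x $ l \<in> {a..a + L}"
      and uncrossed: "\<And>m x. m < n \<Longrightarrow> x \<in> cbox z (z + h *\<^sub>R 1) \<Longrightarrow> \<omega> m \<bullet> x + b m \<noteq> 0"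
      and g: "is_weak_deriv (box 0 1) (\<lambda>l. if l = i then j else 0)
            (\<lambda>x. gaussian x - (\<Sum>m<n. v m * of_real (relu_pow k (\<omega> m \<bullet> x + b m)))) g"
      and w: "j = Suc k \<Longrightarrow> w = 0"
    define \<phi> where "\<phi> = cell_bump z h (\<lambda>l. if l = i then r else 0)"
    define B where "B = box z (z + h *\<^sub>R 1)"
    have sub: "cbox z (z + h *\<^sub>R 1) \<subseteq> box 0 1"
    proof
      fix x assume x: "x \<in> cbox z (z + h *\<^sub>R 1)"
      have "0 < x $ l \<and> x $ l < 1" for l using cell[OF x, of l] aL by auto
      then show "x \<in> box 0 1" by (simp add: mem_box_cart)
    qed
    have lower: "E * h ^ CARD('d) \<le> norm (LINT x|lebesgue. g x * \<phi> x)"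
    proof -
      have "E * h ^ CARD('d) \<le> norm (LINT x|lborel. gaussian x * cell_bump z h (\<lambda>l. if l = i then Suc k else 0) x)"
        unfolding E_def by (rule gaussian_cell_integral_lower_bound[OF c \<sigma> _ _ H h cell]) (use aL in auto)
      then show ?thesis
        unfolding \<phi>_def r_def using integral_weak_derivative_cell_bump[OF h j sub uncrossed g] by simp
    qed
    have Ehpos: "E * h ^ CARD('d) > 0" using E h by simp
    have int: "integrable lebesgue (\<lambda>x. g x * \<phi> x)"
      using lower Ehpos not_integrable_integral_eq by fastforce
    \<comment> \<open>For \<open>r = 0\<close> the test function has nonzero integral, so only \<open>w = 0\<close> is admitted there.\<close>
    have w0: "(LINT x|lebesgue. w * \<phi> x) = 0 \<and> integrable lebesgue (\<lambda>x. w * \<phi> x)"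
    proof (cases "j = Suc k")
      case False
      then have "r > 0" using j by (simp add: r_def)
      have meas: "(\<lambda>x. w * \<phi> x) \<in> borel_measurable lborel"
        unfolding \<phi>_def by (auto intro!: borel_measurable_continuous_onI continuous_intros continuous_on_cell_bump)
      have "(LINT x|lborel. w * \<phi> x) = 0"
        unfolding \<phi>_def by (rule integral_const_cell_bump_eq_0[OF h \<open>r > 0\<close>])
      moreover have "integrable lborel (\<lambda>x. w * \<phi> x)"
        unfolding \<phi>_def by (intro integrable_mult_cell_bump h continuous_intros)
      ultimately show ?thesis
        unfolding integral_completion[OF meas] integrable_completion[OF meas] ..
    qed (simp add: w)
    have "(LINT x|lebesgue. (g x - w) * \<phi> x) = (LINT x|lebesgue. g x * \<phi> x)"
      using int w0 by (simp add: left_diff_distrib)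
    with lower have lower': "E * h ^ CARD('d) \<le> norm (LINT x|lebesgue. (g x - w) * \<phi> x)" by simp
    have "locally_integrable_on (box 0 1) g" using g by (simp add: is_weak_deriv_def)
    from locally_integrable_on_measurable_on_box(1)[OF this sub, of w]
    have meas: "(\<lambda>x. indicator B x *\<^sub>R (g x - w)) \<in> borel_measurable lebesgue" by (simp add: B_def)
    have "ennreal ((E * h ^ CARD('d))\<^sup>2 / ((M / h ^ r)\<^sup>2 * h ^ CARD('d)))
       \<le> (\<integral>\<^sup>+x\<in>B. ennreal ((cmod (g x - w))\<^sup>2) \<partial>lebesgue)"
    proof (rule L2_lower_bound_by_duality[OF _ _ _ meas, of "h ^ CARD('d)" \<phi>])
      show "emeasure lebesgue B = ennreal (h ^ CARD('d))" unfolding B_def by (rule emeasure_cell[OF h])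
      show "\<phi> x = 0" if "x \<notin> B" for x using that cell_bump_eq_0[OF h] by (simp add: \<phi>_def B_def)
      show "norm (\<phi> x) \<le> M / h ^ r" for x unfolding \<phi>_def by (rule M(2)[OF h])
    qed (use lower' Ehpos h M(1) in \<open>auto simp: B_def\<close>)
    moreover have "(E * h ^ CARD('d))\<^sup>2 / ((M / h ^ r)\<^sup>2 * h ^ CARD('d)) = (E / M)\<^sup>2 * h ^ (CARD('d) + 2 * r)"
      using h M(1) by (simp add: field_simps power_add power2_eq_square power_mult)
    ultimately show "ennreal ((E / M)\<^sup>2 * h ^ (CARD('d) + 2 * (Suc k - j)))
            \<le> (\<integral>\<^sup>+x\<in>box z (z + h *\<^sub>R 1). ennreal ((cmod (g x - w))\<^sup>2) \<partial>lebesgue)"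
      by (simp add: r_def B_def)
  qed
qed

lemma L2_sq_ge_sum_cells:
  fixes g :: "real ^ 'd::finite \<Rightarrow> complex"
  assumes G: "finite G" and h: "h > 0"
    and cells: "\<And>\<kappa>. \<kappa> \<in> G \<Longrightarrow> cbox (corner a h \<kappa>) (corner a h \<kappa> + h *\<^sub>R 1) \<subseteq> U"
    and g: "locally_integrable_on U g"
    and T: "\<And>\<kappa>. \<kappa> \<in> G \<Longrightarrow> ennreal T \<le> (\<integral>\<^sup>+x\<in>box (corner a h \<kappa>) (corner a h \<kappa> + h *\<^sub>R 1). ennreal ((cmod (g x))\<^sup>2) \<partial>lebesgue)"
    and T0: "T \<ge> 0"
  shows "ennreal (real (card G) * T) \<le> L2_sq U g"
proof -
  define B where "B \<kappa> = box (corner a h \<kappa>) (corner a h \<kappa> + h *\<^sub>R 1)" for \<kappa> :: "'d \<Rightarrow> nat"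
  have BU: "B \<kappa> \<subseteq> U" if "\<kappa> \<in> G" for \<kappa>
    using cells[OF that] box_subset_cbox unfolding B_def by blast
  have meas: "(\<lambda>x. ennreal ((cmod (g x))\<^sup>2) * indicator (B \<kappa>) x) \<in> borel_measurable lebesgue" if "\<kappa> \<in> G" for \<kappa>
    using locally_integrable_on_measurable_on_box(2)[OF g cells[OF that], of 0] by (simp add: B_def)
  have "disjoint_family_on B G"
    using disjoint_cells[OF h] unfolding disjoint_family_on_def B_def by blast
  then have ind: "(\<Sum>\<kappa>\<in>G. indicator (B \<kappa>) x) = (indicator (\<Union>\<kappa>\<in>G. B \<kappa>) x :: ennreal)" for x
    using indicator_UN_disjoint[OF G] by metis
  have "ennreal (real (card G) * T) = (\<Sum>\<kappa>\<in>G. ennreal T)"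
    using T0 by (simp add: ennreal_mult' ennreal_of_nat_eq_real_of_nat)
  also have "\<dots> \<le> (\<Sum>\<kappa>\<in>G. \<integral>\<^sup>+x\<in>B \<kappa>. ennreal ((cmod (g x))\<^sup>2) \<partial>lebesgue)"
    unfolding B_def by (intro sum_mono T)
  also have "\<dots> = (\<integral>\<^sup>+x. (\<Sum>\<kappa>\<in>G. ennreal ((cmod (g x))\<^sup>2) * indicator (B \<kappa>) x) \<partial>lebesgue)"
    by (rule nn_integral_sum[symmetric]) (rule meas)
  also have "\<dots> \<le> L2_sq U g"
    unfolding L2_sq_def sum_distrib_left[symmetric] ind
    using BU by (intro nn_integral_mono mult_left_mono) (auto simp: indicator_def)
  finally show ?thesis .
qed

text \<open>
  For \<open>x\<close> in a cell it suffices to let \<open>y\<close> range over the same cell, where \<open>|x - y| \<le> d h\<close>. The inner integral is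
  then bounded below uniformly on the cells, so nothing needs to be known about its measurability in \<open>x\<close>.
\<close>

lemma slobodeckij_sq_ge_sum_cells:
  fixes g :: "real ^ 'd::finite \<Rightarrow> complex"
  assumes G: "finite G" and h: "h > 0" and \<theta>: "\<theta> \<ge> 0"
    and cells: "\<And>\<kappa>. \<kappa> \<in> G \<Longrightarrow> cbox (corner a h \<kappa>) (corner a h \<kappa> + h *\<^sub>R 1) \<subseteq> U"
    and g: "locally_integrable_on U g"
    and T: "\<And>\<kappa> w. \<kappa> \<in> G \<Longrightarrow> ennreal T \<le> (\<integral>\<^sup>+y\<in>box (corner a h \<kappa>) (corner a h \<kappa> + h *\<^sub>R 1). ennreal ((cmod (g y - w))\<^sup>2) \<partial>lebesgue)"
    and T0: "T \<ge> 0"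
  shows "ennreal (real (card G) * h ^ CARD('d) * (T / (real CARD('d) * h) powr (real CARD('d) + 2 * \<theta>))) \<le> slobodeckij_sq \<theta> U g"
proof -
  define B where "B \<kappa> = box (corner a h \<kappa>) (corner a h \<kappa> + h *\<^sub>R 1)" for \<kappa> :: "'d \<Rightarrow> nat"
  define D where "D = (real CARD('d) * h) powr (real CARD('d) + 2 * \<theta>)"
  have D: "D > 0" using h by (simp add: D_def)
  define I where "I x = (\<integral>\<^sup>+y\<in>U. ennreal ((cmod (g x - g y))\<^sup>2 / norm (x - y) powr (real CARD('d) + 2 * \<theta>)) \<partial>lebesgue)" for x
  have BU: "B \<kappa> \<subseteq> U" if "\<kappa> \<in> G" for \<kappa>
    using cells[OF that] box_subset_cbox unfolding B_def by blast
  have inner: "ennreal (T / D) \<le> I x" if \<kappa>: "\<kappa> \<in> G" and x: "x \<in> B \<kappa>" for \<kappa> x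
  proof -
    have pt: "ennreal (1 / D) * (ennreal ((cmod (g y - g x))\<^sup>2) * indicator (B \<kappa>) y)
        \<le> ennreal ((cmod (g x - g y))\<^sup>2 / norm (x - y) powr (real CARD('d) + 2 * \<theta>)) * indicator U y" for y
    proof (cases "y \<in> B \<kappa> \<and> y \<noteq> x")
      case True
      have "\<bar>(x - y) $ l\<bar> \<le> h" for l
      proof -
        have "corner a h \<kappa> $ l < x $ l \<and> x $ l < corner a h \<kappa> $ l + h" "corner a h \<kappa> $ l < y $ l \<and> y $ l < corner a h \<kappa> $ l + h"
          using x True by (auto simp: B_def mem_box_cart)
        then show ?thesis by (simp add: abs_le_iff)
      qed
      then have "(\<Sum>l\<in>UNIV. \<bar>(x - y) $ l\<bar>) \<le> (\<Sum>l\<in>(UNIV :: 'd set). h)" by (intro sum_mono)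
      then have "norm (x - y) \<le> real CARD('d) * h" using norm_le_l1_cart[of "x - y"] by simp
      then have "norm (x - y) powr (real CARD('d) + 2 * \<theta>) \<le> D"
        unfolding D_def using \<theta> by (intro powr_mono2) auto
      moreover have "norm (x - y) powr (real CARD('d) + 2 * \<theta>) > 0" using True by auto
      ultimately have "1 / D * (cmod (g y - g x))\<^sup>2 \<le> (cmod (g x - g y))\<^sup>2 / norm (x - y) powr (real CARD('d) + 2 * \<theta>)"
        using D by (simp add: norm_minus_commute frac_le)
      moreover have "y \<in> U" using BU[OF \<kappa>] True by auto
      ultimately show ?thesis using True D by (simp add: ennreal_mult[symmetric] ennreal_leI)
    qed auto
    have "ennreal (T / D) = ennreal (1 / D) * ennreal T" using D T0 by (simp add: ennreal_mult[symmetric])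
    also have "\<dots> \<le> ennreal (1 / D) * (\<integral>\<^sup>+y\<in>B \<kappa>. ennreal ((cmod (g y - g x))\<^sup>2) \<partial>lebesgue)"
      unfolding B_def by (intro mult_left_mono T \<kappa>) simp
    also have "\<dots> = (\<integral>\<^sup>+y. ennreal (1 / D) * (ennreal ((cmod (g y - g x))\<^sup>2) * indicator (B \<kappa>) y) \<partial>lebesgue)"
      unfolding B_def
      by (intro nn_integral_cmult[symmetric] locally_integrable_on_measurable_on_box(2)[OF g cells[OF \<kappa>]])
    also have "\<dots> \<le> I x" unfolding I_def by (intro nn_integral_mono pt)
    finally show ?thesis .
  qed
  have dis: "disjoint_family_on B G"
    using disjoint_cells[OF h] unfolding disjoint_family_on_def B_def by blast
  have "emeasure lebesgue (\<Union>\<kappa>\<in>G. B \<kappa>) = (\<Sum>\<kappa>\<in>G. emeasure lebesgue (B \<kappa>))"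
    using G dis by (intro sum_emeasure[symmetric]) (auto simp: B_def[abs_def])
  also have "\<dots> = ennreal (real (card G) * h ^ CARD('d))"
    unfolding B_def emeasure_cell[OF h] using h by (simp add: ennreal_mult' ennreal_of_nat_eq_real_of_nat)
  finally have em: "emeasure lebesgue (\<Union>\<kappa>\<in>G. B \<kappa>) = ennreal (real (card G) * h ^ CARD('d))" .
  have "ennreal (real (card G) * h ^ CARD('d) * (T / D)) = ennreal (T / D) * emeasure lebesgue (\<Union>\<kappa>\<in>G. B \<kappa>)"
    unfolding em using h T0 D by (simp add: ennreal_mult[symmetric] mult.commute)
  also have "\<dots> = (\<integral>\<^sup>+x. ennreal (T / D) * indicator (\<Union>\<kappa>\<in>G. B \<kappa>) x \<partial>lebesgue)"
    using G by (intro nn_integral_cmult_indicator[symmetric]) (auto simp: B_def)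
  also have "\<dots> \<le> (\<integral>\<^sup>+x\<in>U. I x \<partial>lebesgue)"
    using inner BU by (intro nn_integral_mono) (auto simp: indicator_def)
  finally show ?thesis by (simp add: slobodeckij_sq_def I_def D_def)
qed

section \<open>Summation over the uncrossed cells\<close>

lemma finite_order_mi_le: "finite {\<alpha> :: 'd::finite \<Rightarrow> nat. order_mi \<alpha> \<le> j}"
proof (rule finite_subset[OF _ finite_grid])
  show "{\<alpha> :: 'd \<Rightarrow> nat. order_mi \<alpha> \<le> j} \<subseteq> grid (Suc j)"
  proof
    fix \<alpha> :: "'d \<Rightarrow> nat" assume "\<alpha> \<in> {\<alpha>. order_mi \<alpha> \<le> j}"
    then have "\<alpha> l \<le> j" for l
      using member_le_sum[of l UNIV \<alpha>] by (simp add: order_mi_def)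
    then show "\<alpha> \<in> grid (Suc j)" by (simp add: grid_def less_Suc_eq_le)
  qed
qed

lemma order_mi_single: "order_mi (\<lambda>l. if l = i then j else 0) = j"
  by (simp add: order_mi_def)

text \<open>
  Only one summand of \<open>sobolev_sq\<close> is kept: the derivative of order \<open>\<lfloor>m\<rfloor>\<close> in direction \<open>i\<close>, in the \<open>L\<^sup>2\<close> part
  for integer \<open>m\<close> and in the seminorm otherwise. In both cases the uncrossed cells contribute
  \<open>h\<close> to the power \<open>2 (k + 1 - m)\<close> up to a constant, and \<open>h\<close> is inversely proportional to \<open>n\<close>.
\<close>

lemma sobolev_sq_lower_bound:
  fixes m :: real and k :: nat and i :: "'d::finite"
  assumes m: "0 \<le> m" "m \<le> real k + 1"
  obtains K where "K > 0"
    "\<And>(n :: nat) v \<omega> b. n \<ge> 1 \<Longrightarrow> (\<And>l. l < n \<Longrightarrow> \<omega> l \<in> sphere 0 1)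
       \<Longrightarrow> (\<exists>g. is_weak_deriv (box 0 1) (\<lambda>l. if l = i then nat \<lfloor>m\<rfloor> else 0)
             (\<lambda>x. gaussian x - (\<Sum>l<n. v l * of_real (relu_pow k (\<omega> l \<bullet> x + b l)))) g)
       \<Longrightarrow> ennreal (K * real n powr (2 * (m - (real k + 1))))
            \<le> sobolev_sq m (box 0 1) (\<lambda>x. gaussian x - (\<Sum>l<n. v l * of_real (relu_pow k (\<omega> l \<bullet> x + b l))))"
proof -
  define j where "j = nat \<lfloor>m\<rfloor>"
  define r where "r = Suc k - j"
  have mj: "real j + frac m = m" using m by (simp add: j_def frac_def)
  have "real j \<le> real k + 1" using mj m frac_ge_0[of m] by linarith
  then have j: "j \<le> Suc k" by linarith
  have rj: "real r = real k + 1 - real j" using j by (simp add: r_def of_nat_diff)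
  obtain a L C where aL: "0 < a" "0 < L" "a + L < 1" and C: "C > 0"
    and bound: "\<And>z h (n :: nat) v \<omega> b g w. h > 0
      \<Longrightarrow> (\<And>x l. x \<in> cbox z (z + h *\<^sub>R 1) \<Longrightarrow> x $ l \<in> {a..a + L})
      \<Longrightarrow> (\<And>l x. l < n \<Longrightarrow> x \<in> cbox z (z + h *\<^sub>R 1) \<Longrightarrow> \<omega> l \<bullet> x + b l \<noteq> 0)
      \<Longrightarrow> is_weak_deriv (box 0 1) (\<lambda>l. if l = i then j else 0)
            (\<lambda>x. gaussian x - (\<Sum>l<n. v l * of_real (relu_pow k (\<omega> l \<bullet> x + b l)))) g
      \<Longrightarrow> (j = Suc k \<Longrightarrow> w = 0)
      \<Longrightarrow> ennreal (C * h ^ (CARD('d) + 2 * (Suc k - j)))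
            \<le> (\<integral>\<^sup>+x\<in>box z (z + h *\<^sub>R 1). ennreal ((cmod (g x - w))\<^sup>2) \<partial>lebesgue)"
    using weak_derivative_cell_lower_bound[OF j, of i] by blast
  define \<theta> where "\<theta> = frac m"
  define c1 where "c1 = (if m \<in> \<int> then C * L ^ CARD('d) / 2
     else C * L ^ CARD('d) / 2 / real CARD('d) powr (real CARD('d) + 2 * \<theta>))"
  have c1: "c1 > 0" using C aL by (simp add: c1_def)
  define q where "q = L / (2 * (real CARD('d) + 1))"
  have q: "q > 0" using aL by (simp add: q_def)
  define p where "p = 2 * (real k + 1 - m)"
  show ?thesis
  proof (rule that[of "c1 * q powr p"])
    show "c1 * q powr p > 0" using c1 q by simp
    fix n :: nat and v :: "nat \<Rightarrow> complex" and \<omega> :: "nat \<Rightarrow> real ^ 'd" and b :: "nat \<Rightarrow> real"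
    assume n: "n \<ge> 1" and \<omega>: "\<And>l. l < n \<Longrightarrow> \<omega> l \<in> sphere 0 1"
    define F where "F = (\<lambda>x. gaussian x - (\<Sum>l<n. v l * of_real (relu_pow k (\<omega> l \<bullet> x + b l))))"
    define \<alpha> where "\<alpha> = (\<lambda>l. if l = i then j else 0)"
    assume "\<exists>g. is_weak_deriv (box 0 1) (\<lambda>l. if l = i then nat \<lfloor>m\<rfloor> else 0)
             (\<lambda>x. gaussian x - (\<Sum>l<n. v l * of_real (relu_pow k (\<omega> l \<bullet> x + b l)))) g"
    then have "\<exists>g. is_weak_deriv (box 0 1) \<alpha> F g" unfolding F_def \<alpha>_def j_def .
    then have weak: "is_weak_deriv (box 0 1) \<alpha> F (weak_deriv (box 0 1) \<alpha> F)"
      unfolding weak_deriv_def by (rule someI_ex)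
    define g where "g = weak_deriv (box 0 1) \<alpha> F"
    \<comment> \<open>Twice the number of cells of a column that one hyperplane can cross, for each of the \<open>n\<close> hyperplanes.\<close>
    define N where "N = 2 * (CARD('d) + 1) * n"
    define h where "h = L / real N"
    have N: "N > 0" using n by (simp add: N_def)
    have h: "h > 0" using aL N by (simp add: h_def)
    have Nh: "real N * h = L" using N by (simp add: h_def)
    define G where "G = {\<kappa> \<in> grid N. \<forall>l<n. \<forall>x \<in> cbox (corner a h \<kappa>) (corner a h \<kappa> + h *\<^sub>R 1). \<omega> l \<bullet> x + b l \<noteq> 0}"
    have finG: "finite G" unfolding G_def by (rule finite_subset[OF _ finite_grid]) auto
    have "N ^ CARD('d) \<le> 2 * card G"
      unfolding G_def by (rule many_uncrossed_cells[OF _ h n N_def]) (use \<omega> in force)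
    then have "real (N ^ CARD('d)) \<le> real (2 * card G)" by (rule of_nat_mono)
    then have "real N ^ CARD('d) * h ^ CARD('d) \<le> 2 * real (card G) * h ^ CARD('d)"
      using h by (intro mult_right_mono) auto
    then have cardG: "L ^ CARD('d) / 2 \<le> real (card G) * h ^ CARD('d)"
      by (simp add: power_mult_distrib[symmetric] Nh)
    have cell: "x $ l \<in> {a..a + L}" if "\<kappa> \<in> G" "x \<in> cbox (corner a h \<kappa>) (corner a h \<kappa> + h *\<^sub>R 1)" for \<kappa> x l
    proof -
      have x: "a + h * real (\<kappa> l) \<le> x $ l" "x $ l \<le> a + h * real (\<kappa> l) + h"
        using that(2) by (auto simp: mem_box_cart corner_def)
      have "\<kappa> l < N" using that(1) by (auto simp: G_def grid_def)
      then have "h * (real (\<kappa> l) + 1) \<le> h * real N" using h by (intro mult_left_mono) auto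
      then have "h * real (\<kappa> l) + h \<le> L" using Nh by (simp add: algebra_simps)
      moreover have "0 \<le> h * real (\<kappa> l)" using h by simp
      ultimately show ?thesis unfolding atLeastAtMost_iff using x by linarith
    qed
    have cellU: "cbox (corner a h \<kappa>) (corner a h \<kappa> + h *\<^sub>R 1) \<subseteq> box 0 1" if "\<kappa> \<in> G" for \<kappa>
    proof
      fix x assume x: "x \<in> cbox (corner a h \<kappa>) (corner a h \<kappa> + h *\<^sub>R 1)"
      have "0 < x $ l \<and> x $ l < 1" for l using cell[OF that x, of l] aL by auto
      then show "x \<in> box 0 1" by (simp add: mem_box_cart)
    qed
    have loc: "locally_integrable_on (box 0 1) g" using weak by (simp add: is_weak_deriv_def g_def)
    define T where "T = C * h ^ (CARD('d) + 2 * r)"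
    have T0: "T \<ge> 0" using C h by (simp add: T_def)
    have T: "ennreal T \<le> (\<integral>\<^sup>+x\<in>box (corner a h \<kappa>) (corner a h \<kappa> + h *\<^sub>R 1). ennreal ((cmod (g x - w))\<^sup>2) \<partial>lebesgue)"
      if "\<kappa> \<in> G" "j = Suc k \<Longrightarrow> w = 0" for \<kappa> w
      unfolding T_def r_def
    proof (rule bound[OF h cell[OF that(1)] _ weak[folded g_def, unfolded F_def \<alpha>_def] that(2)])
      show "\<omega> l \<bullet> x + b l \<noteq> 0" if "l < n" "x \<in> cbox (corner a h \<kappa>) (corner a h \<kappa> + h *\<^sub>R 1)" for l x
        using that \<open>\<kappa> \<in> G\<close> by (auto simp: G_def)
    qed
    have hq: "h = q / real n" by (simp add: h_def q_def N_def field_simps)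
    have target: "c1 * q powr p * real n powr (2 * (m - (real k + 1))) = c1 * h powr p"
    proof -
      have "h powr p = q powr p / real n powr p" unfolding hq using q by (simp add: powr_divide)
      moreover have "2 * (m - (real k + 1)) = - p" by (simp add: p_def)
      ultimately show ?thesis by (simp add: powr_minus divide_inverse)
    qed
    have "ennreal (c1 * h powr p) \<le> sobolev_sq m (box 0 1) F"
    proof (cases "m \<in> \<int>")
      case True
      then have "frac m = 0" by (simp add: frac_eq_0_iff)
      then have "m = real j" using mj by (metis add.right_neutral)
      then have "p = real (2 * r)" using rj by (simp add: p_def)
      then have hp: "h powr p = h ^ (2 * r)" using h by (simp only: powr_realpow)
      have "c1 * h powr p = (L ^ CARD('d) / 2) * (C * h ^ (2 * r))"
        unfolding hp using True by (simp add: c1_def)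
      also have "\<dots> \<le> (real (card G) * h ^ CARD('d)) * (C * h ^ (2 * r))"
        using cardG C h by (intro mult_right_mono) auto
      also have "\<dots> = real (card G) * T" by (simp add: T_def power_add)
      finally have "ennreal (c1 * h powr p) \<le> ennreal (real (card G) * T)" by (rule ennreal_leI)
      also have "\<dots> \<le> L2_sq (box 0 1) g"
        using T[where w = 0] by (intro L2_sq_ge_sum_cells[OF finG h cellU loc _ T0]) auto
      also have "\<dots> \<le> (\<Sum>\<alpha> | order_mi \<alpha> \<le> nat \<lfloor>m\<rfloor>. L2_sq (box 0 1) (weak_deriv (box 0 1) \<alpha> F))"
        unfolding g_def
        by (rule member_le_sum) (auto simp: \<alpha>_def order_mi_single j_def finite_order_mi_le)
      also have "\<dots> \<le> sobolev_sq m (box 0 1) F" unfolding sobolev_sq_def by simp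
      finally show ?thesis .
    next
      case False
      have \<theta>: "\<theta> > 0" using False by (simp add: \<theta>_def frac_gt_0_iff)
      have mj': "m = real j + \<theta>" using mj by (simp only: \<theta>_def)
      then have jk: "j \<noteq> Suc k" using m \<theta> by auto
      have pr: "p = real (2 * r) - 2 * \<theta>" unfolding p_def mj' using rj by simp
      define D where "D = real CARD('d) powr (real CARD('d) + 2 * \<theta>)"
      have D: "D > 0" by (simp add: D_def)
      have T': "T / (real CARD('d) * h) powr (real CARD('d) + 2 * \<theta>) = C / D * h powr p"
      proof -
        have "T = C * h powr (real CARD('d) + real (2 * r))"
          unfolding T_def using h by (simp only: of_nat_add[symmetric] powr_realpow)
        moreover have "(real CARD('d) * h) powr (real CARD('d) + 2 * \<theta>) = D * h powr (real CARD('d) + 2 * \<theta>)"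
          using h by (simp add: powr_mult D_def)
        moreover have "h powr (real CARD('d) + real (2 * r)) = h powr p * h powr (real CARD('d) + 2 * \<theta>)"
          unfolding powr_add[symmetric] pr by (simp add: algebra_simps)
        ultimately show ?thesis using h by simp
      qed
      have "c1 * h powr p = (L ^ CARD('d) / 2) * (C / D * h powr p)"
        using False by (simp add: c1_def D_def)
      also have "\<dots> \<le> (real (card G) * h ^ CARD('d)) * (C / D * h powr p)"
        using cardG C D by (intro mult_right_mono) auto
      finally have "ennreal (c1 * h powr p)
          \<le> ennreal (real (card G) * h ^ CARD('d) * (T / (real CARD('d) * h) powr (real CARD('d) + 2 * \<theta>)))"
        unfolding T' by (rule ennreal_leI)
      also have "\<dots> \<le> slobodeckij_sq \<theta> (box 0 1) g"
        using T jk \<theta> by (intro slobodeckij_sq_ge_sum_cells[OF finG h _ cellU loc _ T0]) auto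
      also have "\<dots> \<le> (\<Sum>\<alpha> | order_mi \<alpha> = nat \<lfloor>m\<rfloor>. slobodeckij_sq (frac m) (box 0 1) (weak_deriv (box 0 1) \<alpha> F))"
        unfolding g_def \<theta>_def
        by (rule member_le_sum) (auto simp: \<alpha>_def order_mi_single j_def intro: finite_subset[OF _ finite_order_mi_le])
      also have "\<dots> \<le> sobolev_sq m (box 0 1) F" unfolding sobolev_sq_def using False by simp
      finally show ?thesis .
    qed
    then show "ennreal (c1 * q powr p * real n powr (2 * (m - (real k + 1))))
       \<le> sobolev_sq m (box 0 1) (\<lambda>x. gaussian x - (\<Sum>l<n. v l * of_real (relu_pow k (\<omega> l \<bullet> x + b l))))"
      unfolding target F_def .
  qed
qed

theorem theorem7:
  fixes s m :: real and k :: nat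
  assumes "0 \<le> s" and "0 \<le> m" and "m \<le> s" and "m \<le> real k + 1"
  shows "\<exists>f \<in> barron_space s (cbox 0 1 :: (real ^ 'd::finite) set). \<exists>c::real. c > 0 \<and>
           (\<forall>n\<ge>1. (INF f\<^sub>n \<in> networks k n. sobolev_norm m (cbox 0 1) (\<lambda>x. f x - f\<^sub>n x))
                    \<ge> ennreal (c * real n powr (m - (real k + 1))))"
proof -
  \<comment> \<open>The direction of differentiation is arbitrary.\<close>
  define i :: 'd where "i = undefined"
  obtain K where K: "K > 0"
    and bound: "\<And>(n :: nat) v \<omega> b. n \<ge> 1 \<Longrightarrow> (\<And>l. l < n \<Longrightarrow> \<omega> l \<in> sphere 0 1)
       \<Longrightarrow> (\<exists>g. is_weak_deriv (box 0 1) (\<lambda>l. if l = i then nat \<lfloor>m\<rfloor> else 0)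
             (\<lambda>x. gaussian x - (\<Sum>l<n. v l * of_real (relu_pow k (\<omega> l \<bullet> x + b l)))) g)
       \<Longrightarrow> ennreal (K * real n powr (2 * (m - (real k + 1))))
            \<le> sobolev_sq m (box 0 1) (\<lambda>x. gaussian x - (\<Sum>l<n. v l * of_real (relu_pow k (\<omega> l \<bullet> x + b l))))"
    using sobolev_sq_lower_bound[OF assms(2,4), of i] by blast
  have "ennreal (sqrt K * real n powr (m - (real k + 1))) \<le> sobolev_norm m (cbox 0 1) (\<lambda>x. gaussian x - f\<^sub>n x)"
    if n: "n \<ge> 1" and f: "f\<^sub>n \<in> networks k n" for n and f\<^sub>n :: "real ^ 'd \<Rightarrow> complex"
  proof -
    obtain v \<omega> b where f_eq: "f\<^sub>n = (\<lambda>x. \<Sum>l<n. v l * of_real (relu_pow k (\<omega> l \<bullet> x + b l)))"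
      and \<omega>: "\<forall>l<n. \<omega> l \<in> sphere 0 1" using f unfolding networks_def by blast
    define F where "F = (\<lambda>x. gaussian x - f\<^sub>n x)"
    show ?thesis
    proof (cases "(\<forall>\<alpha>. order_mi \<alpha> \<le> nat \<lfloor>m\<rfloor> \<longrightarrow> (\<exists>g. is_weak_deriv (box 0 1) \<alpha> F g)) \<and> sobolev_sq m (box 0 1) F < \<infinity>")
      case True
      then have "\<exists>g. is_weak_deriv (box 0 1) (\<lambda>l. if l = i then nat \<lfloor>m\<rfloor> else 0) F g"
        using order_mi_single[of i "nat \<lfloor>m\<rfloor>"] by simp
      then have lower: "ennreal (K * real n powr (2 * (m - (real k + 1)))) \<le> sobolev_sq m (box 0 1) F"
        unfolding F_def f_eq using n \<omega> by (intro bound) auto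
      have "K * real n powr (2 * (m - (real k + 1))) = enn2real (ennreal (K * real n powr (2 * (m - (real k + 1)))))"
        using K by simp
      also have "\<dots> \<le> enn2real (sobolev_sq m (box 0 1) F)"
        using lower True by (intro enn2real_mono) auto
      finally have "sqrt (K * real n powr (2 * (m - (real k + 1)))) \<le> sqrt (enn2real (sobolev_sq m (box 0 1) F))"
        by (rule real_sqrt_le_mono)
      moreover have "sqrt (K * real n powr (2 * (m - (real k + 1)))) = sqrt K * real n powr (m - (real k + 1))"
      proof -
        have "real n powr (2 * e) = (real n powr e)\<^sup>2" for e
          by (simp add: power2_eq_square powr_add[symmetric])
        then show ?thesis by (simp only: real_sqrt_mult) simp
      qed
      moreover have "sobolev_norm m (cbox 0 1) F = ennreal (sqrt (enn2real (sobolev_sq m (box 0 1) F)))"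
        using True by (simp add: sobolev_norm_def interior_cbox)
      ultimately show ?thesis unfolding F_def by (simp only: ennreal_leI)
    next
      case False
      then have "sobolev_norm m (cbox 0 1) F = \<infinity>" unfolding sobolev_norm_def interior_cbox by (rule if_not_P)
      then show ?thesis by (simp add: F_def)
    qed
  qed
  then have "\<forall>n\<ge>1. (INF f\<^sub>n \<in> networks k n. sobolev_norm m (cbox 0 1) (\<lambda>x. gaussian (x :: real ^ 'd) - f\<^sub>n x))
                    \<ge> ennreal (sqrt K * real n powr (m - (real k + 1)))"
    by (intro allI impI INF_greatest)
  moreover have "sqrt K > 0" using K by simp
  ultimately show ?thesis using gaussian_in_barron_space by blast
qed

end
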